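(* For an integer $d\ge 2$, let $$\eta_d=\tan\frac{\pi}{4(d-1)},$$ so that $\eta_2=1$, $\eta_3=\sqrt{2}-1\approx 0.414$, $\eta_4=2-\sqrt{3}\approx 0.268$, etc. For any $0\le\eta<\eta_d$ there is a constant $\gamma=\gamma(d,\eta)$ and for any positive integer $n$ and real $0<\epsilon<1$ there is a polynomial $p=p_{d,\eta,\epsilon,n}$ in the entries of a $d$-dimensional $n\times\cdots\times n$ tensor such that $\deg p\le\gamma(\ln n-\ln\epsilon)$ and $$\left|\ln\operatorname{PER}A-p(A)\right|\le\epsilon$$ for any $d$-dimensional $n\times\cdots\times n$ real tensor $A=(a_{i_1\ldots i_d})$ satisfying $|1-a_{i_1\ldots i_d}|\le\eta$ for all $1\le i_1,\dots,i_d\le n$.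
   Context: The permanent of a $d$-dimensional $n\times\cdots\times n$ array (tensor) $A=(a_{i_1\ldots i_d})$ of $n^d$ real or complex numbers is $$\operatorname{PER}A=\sum_{\sigma_2,\dots,\sigma_d\in S_n}\ \prod_{i=1}^n a_{i\,\sigma_2(i)\ldots\sigma_d(i)},$$ where $S_n$ is the symmetric group of permutations of $\{1,\dots,n\}$.
   Formalization: For n = 1 the claim is stated only for η < tanh 1 (a restriction only when d = 2): for n = 1, η ≥ tanh 1 and ε near 1 the degree bound forces p to be constant, while ln a on [1−η, 1+η] has no constant approximation with error below 1. *)

theory Defs
  imports Complex_Main "HOL-Library.Poly_Mapping" "HOL-Combinatorics.Permutations"
begin

(* A tensor is a function on index lists [i_1, ..., i_d]; only its values on
   tensor_indices d n are entries, the values elsewhere are irrelevant. *)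
definition tensor_indices :: "nat \<Rightarrow> nat \<Rightarrow> nat list set" where
  "tensor_indices d n = {is. length is = d \<and> set is \<subseteq> {1..n}}"

(* The list ss = [\<sigma>_2, ..., \<sigma>_d] runs over all (d-1)-tuples of permutations of {1..n}. *)
definition PER :: "nat \<Rightarrow> nat \<Rightarrow> (nat list \<Rightarrow> 'a) \<Rightarrow> 'a :: comm_ring_1" where
  "PER d n A =
     (\<Sum>ss \<in> {ss. length ss = d - 1 \<and> set ss \<subseteq> {\<sigma>. \<sigma> permutes {1..n}}}.
        \<Prod>i = 1..n. A (i # map (\<lambda>\<sigma>. \<sigma> i) ss))"

definition eta_bound :: "nat \<Rightarrow> real" where
  "eta_bound d = tan (pi / (4 * (real d - 1)))"

(* Multivariate polynomials with variables 'v: finitely supported coefficient functions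
   on monomials, a monomial being a finitely supported exponent function. *)
type_synonym ('v, 'a) mpolynomial = "('v \<Rightarrow>\<^sub>0 nat) \<Rightarrow>\<^sub>0 'a"

definition mpoly_vars :: "('v, 'a :: zero) mpolynomial \<Rightarrow> 'v set" where
  "mpoly_vars p = (\<Union>m \<in> Poly_Mapping.keys p. Poly_Mapping.keys m)"

definition mpoly_eval :: "('v \<Rightarrow> 'a) \<Rightarrow> ('v, 'a :: comm_semiring_1) mpolynomial \<Rightarrow> 'a" where
  "mpoly_eval a p =
     (\<Sum>m \<in> Poly_Mapping.keys p. Poly_Mapping.lookup p m *
        (\<Prod>v \<in> Poly_Mapping.keys m. a v ^ Poly_Mapping.lookup m v))"

(* Total degree; the zero polynomial gets degree 0. *)
definition mpoly_degree :: "('v, 'a :: zero) mpolynomial \<Rightarrow> nat" where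
  "mpoly_degree p =
     Max (insert 0 ((\<lambda>m. \<Sum>v \<in> Poly_Mapping.keys m. Poly_Mapping.lookup m v) ` Poly_Mapping.keys p))"

(* The degree bound \<gamma> (ln n - ln \<epsilon>) needs the side condition  n \<ge> 2 \<or> \<eta> < tanh 1.  For n = 1 it
   tends to 0 as \<epsilon> \<rightarrow> 1, so p must then be constant; but for n = 1 we have ln (PER A) = ln a with
   a ranging over [1 - \<eta>, 1 + \<eta>], whose best constant approximation has error
   ln ((1 + \<eta>) / (1 - \<eta>)) / 2 = artanh \<eta>, and this is \<ge> 1 > \<epsilon> once \<eta> \<ge> tanh 1.
   Since eta_bound 3 = sqrt 2 - 1 < tanh 1, the condition matters only for d = 2 and n = 1. *)

end

theory Submission
  imports Defs "HOL-Complex_Analysis.Complex_Analysis"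
begin

text \<open>
  The idea is to join the tensor \<open>J\<close> of all ones to \<open>A\<close> by a curve of complex tensors along which
  the permanent does not vanish, and to expand the logarithm of the permanent at \<open>J\<close>. With
  \<open>N = PER J\<close>, consider \<open>g(z) = PER (J + \<phi>(z) (A - J)) / N\<close> for a fixed holomorphic \<open>\<phi>\<close> with
  \<open>\<phi>(0) = 0\<close> and \<open>\<phi>(1) = 1\<close>. If \<open>g\<close> has no zero in a disc of radius \<open>R > 1\<close> about 0, then
  \<open>g = exp h\<close> there, and \<open>ln (PER A) = ln N + h(1)\<close>. The polynomial \<open>p\<close> is \<open>ln N\<close> plus the Taylor
  polynomial of \<open>h\<close> of degree \<open>m\<close>, evaluated at 1.

  It is a polynomial of degree at most \<open>m\<close> in the entries: since \<open>\<phi>(0) = 0\<close>, the coefficient of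
  \<open>z^k\<close> in \<open>g\<close> has degree at most \<open>k\<close> in the entries, and \<open>g' = h' g\<close> determines the coefficients of \<open>h\<close>
  recursively without destroying this (\<open>graded_fps_log\<close>).

  It is close to \<open>ln (PER A)\<close>: \<open>|g|\<close> is at most \<open>3^n\<close>, so \<open>Re h\<close> is less than \<open>3n\<close>, the
  Borel--Caratheodory inequality bounds \<open>|h|\<close> by a multiple of \<open>n\<close> on a smaller disc of radius
  \<open>r > 1\<close>, and by Cauchy's inequality the \<open>k\<close>-th coefficient is \<open>O(n / r^k)\<close>
  (\<open>Taylor_truncation_bound\<close>). Hence \<open>m = O(ln n - ln \<epsilon>)\<close> terms suffice.

  The zero-free disc is where \<open>eta_bound\<close> enters. The permanent is nonzero as soon as the real
  parts of the entries are within some \<open>\<eta>' > \<eta>\<close> of 1 and the imaginary parts are small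
  (\<open>matching_sum_nonzero_and_angle\<close>). The proof is an induction on \<open>n\<close> which also shows that replacing one slice
  turns the permanent by an angle of at most \<open>2 arctan \<kappa>\<close>, for some \<open>\<kappa>\<close> between \<open>\<eta>'\<close> and
  \<open>eta_bound d\<close>. In a Laplace expansion along a slice, any two minors are related by at most
  \<open>d - 1\<close> replacements of slices, so the angle between them is at most
  \<open>(d - 1) * 2 arctan \<kappa>\<close>, which is at most \<open>pi/2\<close> exactly when \<open>\<kappa>\<close> is at most \<open>eta_bound d\<close>.
  For vectors in the plane with pairwise angles at most \<open>pi/2\<close>, changing the weights within the
  allowed box turns their weighted sum by at most \<open>2 arctan \<kappa>\<close> again
  (\<open>abs_Arg_weighted_sums\<close>), and the induction closes. Finally, \<open>\<phi>\<close> has to map the disc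
  into a thin neighbourhood of \<open>[-1, 1]\<close>; a rescaled logarithm does
  (\<open>exists_disc_to_strip_map\<close>).
\<close>

(* From here on $ is the coefficient of a power series. *)
unbundle no vec_syntax

section \<open>Polynomial functions of bounded degree\<close>

text \<open>
  Complex-valued functions of real arguments, because they arise as coefficients of complex power
  series; the polynomial itself has real coefficients, which is what makes those coefficients real.
\<close>

definition polynomial_fun :: "'v set \<Rightarrow> nat \<Rightarrow> (('v \<Rightarrow> real) \<Rightarrow> complex) \<Rightarrow> bool" where
  "polynomial_fun V k f \<longleftrightarrow>
     (\<exists>p. mpoly_vars p \<subseteq> V \<and> mpoly_degree p \<le> k \<and> (\<forall>a. f a = of_real (mpoly_eval a p)))"

lemma mpoly_degree_le_iff:
  "mpoly_degree p \<le> k \<longleftrightarrow>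
     (\<forall>m \<in> Poly_Mapping.keys p. (\<Sum>v \<in> Poly_Mapping.keys m. Poly_Mapping.lookup m v) \<le> k)"
  by (simp add: mpoly_degree_def)

lemma monomial_eval_superset:
  fixes a :: "'v \<Rightarrow> 'a :: comm_semiring_1"
  assumes "finite S" "Poly_Mapping.keys m \<subseteq> S"
  shows "(\<Prod>v \<in> Poly_Mapping.keys m. a v ^ Poly_Mapping.lookup m v) =
         (\<Prod>v \<in> S. a v ^ Poly_Mapping.lookup m v)"
  using assms by (intro prod.mono_neutral_left) (auto simp: in_keys_iff)

lemma monomial_degree_superset:
  fixes m :: "'v \<Rightarrow>\<^sub>0 nat"
  assumes "finite S" "Poly_Mapping.keys m \<subseteq> S"
  shows "(\<Sum>v \<in> Poly_Mapping.keys m. Poly_Mapping.lookup m v) =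
         (\<Sum>v \<in> S. Poly_Mapping.lookup m v)"
  using assms by (intro sum.mono_neutral_left) (auto simp: in_keys_iff)

lemma monomial_eval_add:
  fixes a :: "'v \<Rightarrow> 'a :: comm_semiring_1" and m m' :: "'v \<Rightarrow>\<^sub>0 nat"
  shows "(\<Prod>v \<in> Poly_Mapping.keys (m + m'). a v ^ Poly_Mapping.lookup (m + m') v) =
         (\<Prod>v \<in> Poly_Mapping.keys m. a v ^ Poly_Mapping.lookup m v) *
         (\<Prod>v \<in> Poly_Mapping.keys m'. a v ^ Poly_Mapping.lookup m' v)"
proof -
  let ?S = "Poly_Mapping.keys m \<union> Poly_Mapping.keys m'"
  have "Poly_Mapping.keys (m + m') \<subseteq> ?S" by (rule Poly_Mapping.keys_add)
  then show ?thesis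
    by (subst (1 2 3) monomial_eval_superset[of ?S])
       (simp_all add: prod.distrib[symmetric] lookup_add power_add)
qed

lemma monomial_degree_add:
  fixes m m' :: "'v \<Rightarrow>\<^sub>0 nat"
  shows "(\<Sum>v \<in> Poly_Mapping.keys (m + m'). Poly_Mapping.lookup (m + m') v) =
         (\<Sum>v \<in> Poly_Mapping.keys m. Poly_Mapping.lookup m v) +
         (\<Sum>v \<in> Poly_Mapping.keys m'. Poly_Mapping.lookup m' v)"
proof -
  let ?S = "Poly_Mapping.keys m \<union> Poly_Mapping.keys m'"
  have "Poly_Mapping.keys (m + m') \<subseteq> ?S" by (rule Poly_Mapping.keys_add)
  then show ?thesis
    by (subst (1 2 3) monomial_degree_superset[of ?S])
       (simp_all add: sum.distrib[symmetric] lookup_add)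
qed

lemma mpoly_eval_superset:
  fixes p :: "('v, 'a :: comm_semiring_1) mpolynomial"
  assumes "finite S" "Poly_Mapping.keys p \<subseteq> S"
  shows "mpoly_eval a p = (\<Sum>m \<in> S. Poly_Mapping.lookup p m *
        (\<Prod>v \<in> Poly_Mapping.keys m. a v ^ Poly_Mapping.lookup m v))"
  unfolding mpoly_eval_def using assms
  by (intro sum.mono_neutral_left) (auto simp: in_keys_iff)

lemma mpoly_eval_single:
  fixes c :: "'a :: comm_semiring_1"
  shows "mpoly_eval a (Poly_Mapping.single m c) =
         c * (\<Prod>v \<in> Poly_Mapping.keys m. a v ^ Poly_Mapping.lookup m v)"
  by (simp add: mpoly_eval_def)

lemma mpoly_eval_add:
  fixes p q :: "('v, 'a :: comm_semiring_1) mpolynomial"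
  shows "mpoly_eval a (p + q) = mpoly_eval a p + mpoly_eval a q"
proof -
  let ?S = "Poly_Mapping.keys p \<union> Poly_Mapping.keys q"
  have "Poly_Mapping.keys (p + q) \<subseteq> ?S" by (rule Poly_Mapping.keys_add)
  then show ?thesis
    by (simp add: mpoly_eval_superset[of ?S] sum.distrib[symmetric] lookup_add distrib_right)
qed

lemma mpoly_eval_sum:
  fixes p :: "'i \<Rightarrow> ('v, 'a :: comm_semiring_1) mpolynomial"
  shows "mpoly_eval a (\<Sum>i\<in>I. p i) = (\<Sum>i\<in>I. mpoly_eval a (p i))"
  by (induction I rule: infinite_finite_induct) (simp_all add: mpoly_eval_add, simp_all add: mpoly_eval_def)

lemma poly_mapping_eq_sum_single:
  "p = (\<Sum>m \<in> Poly_Mapping.keys p. Poly_Mapping.single m (Poly_Mapping.lookup p m))"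
proof (rule poly_mapping_eqI)
  fix k
  show "Poly_Mapping.lookup p k = Poly_Mapping.lookup
      (\<Sum>m \<in> Poly_Mapping.keys p. Poly_Mapping.single m (Poly_Mapping.lookup p m)) k"
    by (cases "k \<in> Poly_Mapping.keys p")
       (auto simp: lookup_sum lookup_single when_def in_keys_iff sum.delta')
qed

lemma mpoly_eval_mult:
  fixes p q :: "('v, 'a :: comm_semiring_1) mpolynomial"
  shows "mpoly_eval a (p * q) = mpoly_eval a p * mpoly_eval a q"
proof -
  have "p * q = (\<Sum>m \<in> Poly_Mapping.keys p. \<Sum>m' \<in> Poly_Mapping.keys q.
      Poly_Mapping.single (m + m') (Poly_Mapping.lookup p m * Poly_Mapping.lookup q m'))"
    by (subst poly_mapping_eq_sum_single[of p], subst poly_mapping_eq_sum_single[of q])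
       (simp add: sum_product mult_single)
  also have "mpoly_eval a \<dots> = mpoly_eval a p * mpoly_eval a q"
    unfolding mpoly_eval_sum mpoly_eval_single monomial_eval_add
    unfolding mpoly_eval_def by (simp add: sum_product mult_ac)
  finally show ?thesis .
qed

lemma polynomial_fun_const: "polynomial_fun V k (\<lambda>_. of_real c)"
  unfolding polynomial_fun_def
  by (rule exI[of _ "Poly_Mapping.single 0 c"])
     (auto simp: mpoly_vars_def mpoly_degree_le_iff mpoly_eval_single)

lemma polynomial_fun_var:
  assumes "v \<in> V"
  shows "polynomial_fun V 1 (\<lambda>a. of_real (a v))"
  unfolding polynomial_fun_def using assms
  by (intro exI[of _ "Poly_Mapping.single (Poly_Mapping.single v 1) 1"])
     (auto simp: mpoly_vars_def mpoly_degree_le_iff mpoly_eval_single)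

lemma polynomial_fun_mono: "polynomial_fun V k f \<Longrightarrow> k \<le> l \<Longrightarrow> polynomial_fun V l f"
  unfolding polynomial_fun_def by (meson le_trans)

lemma polynomial_fun_add:
  assumes "polynomial_fun V k f" "polynomial_fun V k g"
  shows "polynomial_fun V k (\<lambda>a. f a + g a)"
proof -
  obtain p q where "mpoly_vars p \<subseteq> V" "mpoly_degree p \<le> k" "\<And>a. f a = of_real (mpoly_eval a p)"
    "mpoly_vars q \<subseteq> V" "mpoly_degree q \<le> k" "\<And>a. g a = of_real (mpoly_eval a q)"
    using assms unfolding polynomial_fun_def by blast
  moreover from this have "mpoly_vars (p + q) \<subseteq> V" "mpoly_degree (p + q) \<le> k"
    using Poly_Mapping.keys_add[of p q] unfolding mpoly_vars_def mpoly_degree_le_iff by blast+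
  ultimately show ?thesis
    unfolding polynomial_fun_def
    by (intro exI[of _ "p + q"]) (auto simp: mpoly_eval_add)
qed

lemma polynomial_fun_mult:
  assumes "polynomial_fun V k f" "polynomial_fun V l g"
  shows "polynomial_fun V (k + l) (\<lambda>a. f a * g a)"
proof -
  obtain p q where pq: "mpoly_vars p \<subseteq> V" "mpoly_degree p \<le> k" "\<And>a. f a = of_real (mpoly_eval a p)"
    "mpoly_vars q \<subseteq> V" "mpoly_degree q \<le> l" "\<And>a. g a = of_real (mpoly_eval a q)"
    using assms unfolding polynomial_fun_def by blast
  have keys: "\<exists>m m'. x = m + m' \<and> m \<in> Poly_Mapping.keys p \<and> m' \<in> Poly_Mapping.keys q"
    if "x \<in> Poly_Mapping.keys (p * q)" for x
    using Poly_Mapping.keys_mult[of p q] that by blast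
  have "mpoly_vars (p * q) \<subseteq> V"
    using pq(1,4) unfolding mpoly_vars_def
    by (auto dest!: keys) (metis (no_types, lifting) Poly_Mapping.keys_add UN_I UnE subsetD)
  moreover have "mpoly_degree (p * q) \<le> k + l"
    using pq(2,5) unfolding mpoly_degree_le_iff
    by (auto dest!: keys simp: monomial_degree_add intro!: add_mono)
  ultimately show ?thesis
    using pq unfolding polynomial_fun_def
    by (intro exI[of _ "p * q"]) (auto simp: mpoly_eval_mult)
qed

lemma polynomial_fun_sum:
  assumes "\<And>i. i \<in> I \<Longrightarrow> polynomial_fun V k (f i)"
  shows "polynomial_fun V k (\<lambda>a. \<Sum>i\<in>I. f i a)"
  using assms
proof (induction I rule: infinite_finite_induct)
  case (insert x F)
  then show ?case by (simp add: polynomial_fun_add)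
qed (use polynomial_fun_const[of V k 0] in simp_all)

section \<open>Power series graded by degree\<close>

text \<open>
  The power series that occur depend on the entries in such a way that the order in \<open>z\<close> bounds the
  degree in the entries. This property is kept by all operations leading from the entries to the
  logarithm of the permanent.
\<close>

definition graded_fps :: "'v set \<Rightarrow> (('v \<Rightarrow> real) \<Rightarrow> complex fps) \<Rightarrow> bool" where
  "graded_fps V F \<longleftrightarrow> (\<forall>k. polynomial_fun V k (\<lambda>a. F a $ k))"

lemma graded_fps_const: "graded_fps V (\<lambda>_. fps_const (of_real c))"
  unfolding graded_fps_def
proof
  fix k show "polynomial_fun V k (\<lambda>_. fps_const (complex_of_real c) $ k)"
    using polynomial_fun_const[of V k c] polynomial_fun_const[of V k 0] by (cases k) auto
qed

lemma graded_fps_sum: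
  assumes "\<And>i. i \<in> I \<Longrightarrow> graded_fps V (F i)"
  shows "graded_fps V (\<lambda>a. \<Sum>i\<in>I. F i a)"
  unfolding graded_fps_def fps_sum_nth
proof
  fix k
  show "polynomial_fun V k (\<lambda>a. \<Sum>i\<in>I. F i a $ k)"
    by (rule polynomial_fun_sum) (use assms in \<open>simp add: graded_fps_def\<close>)
qed

lemma graded_fps_mult:
  assumes "graded_fps V F" "graded_fps V G"
  shows "graded_fps V (\<lambda>a. F a * G a)"
  unfolding graded_fps_def fps_mult_nth
proof (intro allI polynomial_fun_sum)
  fix k i assume "i \<in> {0..k::nat}"
  then have "k = i + (k - i)" by simp
  then show "polynomial_fun V k (\<lambda>a. F a $ i * G a $ (k - i))"
    using polynomial_fun_mult[of V i "\<lambda>a. F a $ i" "k - i" "\<lambda>a. G a $ (k - i)"] assms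
    unfolding graded_fps_def by metis
qed

lemma graded_fps_prod:
  "(\<And>i. i \<in> I \<Longrightarrow> graded_fps V (F i)) \<Longrightarrow> graded_fps V (\<lambda>a. \<Prod>i\<in>I. F i a)"
proof (induction I rule: infinite_finite_induct)
  case (insert x I)
  then show ?case by (simp add: graded_fps_mult)
qed (use graded_fps_const[of V 1] in simp_all)

text \<open>
  Without a constant term in \<open>F\<close> the entry contributes its degree 1 only from order 1 on.
\<close>

lemma graded_fps_line:
  assumes F: "F $ 0 = 0" "\<And>k. \<exists>c. F $ k = complex_of_real c" and v: "v \<in> V"
  shows "graded_fps V (\<lambda>a. 1 + F * fps_const (of_real (a v) - 1))"
  unfolding graded_fps_def
proof
  fix k
  show "polynomial_fun V k (\<lambda>a. (1 + F * fps_const (complex_of_real (a v) - 1)) $ k)"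
  proof (cases k)
    case 0
    then show ?thesis using F(1) polynomial_fun_const[of V 0 1] by simp
  next
    case (Suc l)
    obtain c where c: "F $ k = complex_of_real c" using F(2) by blast
    have "polynomial_fun V 1 (\<lambda>a. of_real (a v) + of_real (- 1))"
      using v by (intro polynomial_fun_add polynomial_fun_var polynomial_fun_const)
    then have "polynomial_fun V (0 + 1) (\<lambda>a. of_real c * (of_real (a v) + of_real (- 1)))"
      by (intro polynomial_fun_mult polynomial_fun_const)
    then have "polynomial_fun V k (\<lambda>a. of_real c * (of_real (a v) + of_real (- 1)))"
      by (rule polynomial_fun_mono) (use Suc in simp)
    then show ?thesis using c Suc by simp
  qed
qed

text \<open>
  The series is the formal logarithm \<open>H\<close> of \<open>G\<close>. Comparing coefficients in \<open>G' = H' G\<close> expresses the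
  coefficient of \<open>H\<close> at order \<open>k + 1\<close> by the one of \<open>G\<close> and by products of coefficients of \<open>H\<close> and \<open>G\<close>
  whose orders add up to \<open>k + 1\<close>, so that the degrees add up as well.
\<close>

lemma graded_fps_log:
  assumes G: "graded_fps V G" and G0: "\<And>a. G a $ 0 = 1"
  shows "graded_fps V (\<lambda>a. fps_integral0 (fps_deriv (G a) / G a))"
proof -
  define H where "H a = fps_integral0 (fps_deriv (G a) / G a)" for a
  have H0: "H a $ 0 = 0" for a by (simp add: H_def fps_integral_def)
  have deriv: "fps_deriv (G a) = fps_deriv (H a) * G a" for a
  proof -
    have "fps_deriv (H a) = fps_deriv (G a) * inverse (G a)"
      unfolding H_def using G0[of a] by (simp add: fps_deriv_fps_integral fps_divide_unit)
    then show ?thesis using G0[of a] by (simp add: mult.assoc inverse_mult_eq_1)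
  qed
  have solve: "y = x - s / c" if "c * x = c * y + s" "c \<noteq> 0" for c x y s :: complex
    using that by (simp add: field_simps)
  have rec: "H a $ Suc k = G a $ Suc k +
      (\<Sum>i<k. of_real (- real (Suc i) / real (Suc k)) * (H a $ Suc i * G a $ (k - i)))" for a k
  proof -
    have "of_nat (Suc k) * G a $ Suc k = (\<Sum>i=0..k. of_nat (Suc i) * H a $ Suc i * G a $ (k - i))"
      using arg_cong[OF deriv[of a], of "\<lambda>f. f $ k"] by (simp add: fps_mult_nth)
    also have "{0..k} = insert k {..<k}" by auto
    finally have "of_nat (Suc k) * G a $ Suc k = of_nat (Suc k) * H a $ Suc k +
        (\<Sum>i<k. of_nat (Suc i) * H a $ Suc i * G a $ (k - i))"
      by (simp add: G0)
    then have "H a $ Suc k = G a $ Suc k -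
        (\<Sum>i<k. of_nat (Suc i) * H a $ Suc i * G a $ (k - i)) / of_nat (Suc k)"
      by (rule solve) (simp del: of_nat_Suc)
    also have "(\<Sum>i<k. of_nat (Suc i) * H a $ Suc i * G a $ (k - i)) / of_nat (Suc k) =
        - (\<Sum>i<k. of_real (- real (Suc i) / real (Suc k)) * (H a $ Suc i * G a $ (k - i)))"
      unfolding sum_divide_distrib sum_negf[symmetric]
      by (intro sum.cong refl) (simp del: of_nat_Suc)
    finally show ?thesis by simp
  qed
  have "polynomial_fun V k (\<lambda>a. H a $ k)" for k
  proof (induction k rule: less_induct)
    case (less k)
    show ?case
    proof (cases k)
      case 0
      then show ?thesis using H0 polynomial_fun_const[of V 0 0] by simp
    next
      case (Suc l)
      have "polynomial_fun V k (\<lambda>a. of_real (- real (Suc i) / real (Suc l)) *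
          (H a $ Suc i * G a $ (l - i)))" if "i < l" for i
      proof -
        have "polynomial_fun V (Suc i + (l - i)) (\<lambda>a. H a $ Suc i * G a $ (l - i))"
        proof (rule polynomial_fun_mult)
          show "polynomial_fun V (Suc i) (\<lambda>a. H a $ Suc i)" by (rule less) (use that Suc in simp)
          show "polynomial_fun V (l - i) (\<lambda>a. G a $ (l - i))" using G by (simp add: graded_fps_def)
        qed
        from polynomial_fun_mult[OF polynomial_fun_const[of V 0 "- real (Suc i) / real (Suc l)"] this]
        show ?thesis using that Suc by simp
      qed
      then have "polynomial_fun V k (\<lambda>a. \<Sum>i<l. of_real (- real (Suc i) / real (Suc l)) *
          (H a $ Suc i * G a $ (l - i)))"
        by (rule polynomial_fun_sum) simp
      moreover have "polynomial_fun V k (\<lambda>a. G a $ k)" using G by (simp add: graded_fps_def)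
      ultimately have "polynomial_fun V k (\<lambda>a. G a $ k + (\<Sum>i<l.
          of_real (- real (Suc i) / real (Suc l)) * (H a $ Suc i * G a $ (l - i))))"
        by (intro polynomial_fun_add)
      moreover have "(\<lambda>a. H a $ k) = (\<lambda>a. G a $ k + (\<Sum>i<l.
          of_real (- real (Suc i) / real (Suc l)) * (H a $ Suc i * G a $ (l - i))))"
        unfolding Suc by (rule ext) (rule rec)
      ultimately show ?thesis by simp
    qed
  qed
  then show ?thesis by (simp add: graded_fps_def H_def)
qed

text \<open>
  The analytic logarithm has the formal logarithm as its expansion, since both solve \<open>g' = h' g\<close>. The
  formal one is given for all entries at once, the analytic one only where \<open>g\<close> has no zero.
\<close>

lemma fps_expansion_log:
  fixes g h :: "complex \<Rightarrow> complex"
  assumes h: "h holomorphic_on ball 0 R" "h 0 = 0" and R: "R > 0"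
    and exp_h: "\<And>z. z \<in> ball 0 R \<Longrightarrow> g z = exp (h z)"
    and G: "g has_fps_expansion G"
  shows "fps_expansion h 0 = fps_integral0 (fps_deriv G / G)"
proof -
  let ?H = "fps_expansion h 0"
  have H: "h has_fps_expansion ?H"
    by (rule has_fps_expansion_fps_expansion[OF _ _ h(1)]) (use R in auto)
  have ev: "eventually (\<lambda>z. z \<in> ball 0 R) (nhds (0::complex))"
    using R by (intro eventually_nhds_in_open) auto
  have "deriv g z = deriv h z * g z" if z: "z \<in> ball 0 R" for z
  proof -
    have "(h has_field_derivative deriv h z) (at z)"
      using h(1) z by (auto intro!: holomorphic_derivI[of h "ball 0 R"])
    then have "((\<lambda>z. exp (h z)) has_field_derivative exp (h z) * deriv h z) (at z)"
      by (auto intro!: derivative_eq_intros)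
    then have "(g has_field_derivative exp (h z) * deriv h z) (at z)"
      using z exp_h by (subst has_field_derivative_cong_ev[OF refl _ _ refl, of _ _ "\<lambda>z. exp (h z)"])
        (auto intro!: eventually_mono[OF eventually_nhds_in_open[of "ball 0 R" z]])
    then show ?thesis using exp_h[OF z] by (simp add: DERIV_imp_deriv mult.commute)
  qed
  then have "eventually (\<lambda>z. deriv g z = deriv h z * g z) (nhds 0)"
    using ev by (auto elim: eventually_mono)
  then have "deriv g has_fps_expansion fps_deriv ?H * G"
    using has_fps_expansion_cong[of "deriv g" "\<lambda>z. deriv h z * g z"]
      has_fps_expansion_mult[OF has_fps_expansion_deriv[OF H] G] by blast
  then have deriv: "fps_deriv G = fps_deriv ?H * G"
    using has_fps_expansion_deriv[OF G] fps_expansion_unique_complex by blast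
  have "G $ 0 = g 0" using has_fps_expansion_imp_0_eq_fps_nth_0[OF G] ..
  then have G0: "G $ 0 \<noteq> 0" using exp_h[of 0] R by simp
  then have "fps_deriv G / G = fps_deriv ?H"
    unfolding deriv by (simp add: fps_divide_unit mult.assoc inverse_mult_eq_1')
  moreover have "?H $ 0 = 0" using h(2) by (simp add: fps_expansion_def)
  ultimately show ?thesis by (simp add: fps_integral0_deriv)
qed

section \<open>Permanents as sums over perfect matchings\<close>

text \<open>
  A tensor assigns weights to the edges of the complete \<open>d\<close>-partite hypergraph whose parts are the
  index sets \<open>X 0, ..., X (d - 1)\<close>; a set of edges is a perfect matching if it meets every vertex
  exactly once. In this form all \<open>d\<close> directions play the same part, and a minor of the tensor
  is obtained by deleting vertices from the parts, with the tensor itself kept fixed.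
\<close>

definition matchings :: "nat \<Rightarrow> (nat \<Rightarrow> 'v set) \<Rightarrow> 'v list set set" where
  "matchings d X = {M. (\<forall>e\<in>M. length e = d) \<and> (\<forall>k<d. bij_betw (\<lambda>e. e ! k) M (X k))}"

definition matching_sum :: "nat \<Rightarrow> (nat \<Rightarrow> 'v set) \<Rightarrow> ('v list \<Rightarrow> 'a) \<Rightarrow> 'a :: comm_ring_1" where
  "matching_sum d X A = (\<Sum>M \<in> matchings d X. \<Prod>e\<in>M. A e)"

definition edges :: "nat \<Rightarrow> (nat \<Rightarrow> 'v set) \<Rightarrow> 'v list set" where
  "edges d X = {e. length e = d \<and> (\<forall>k<d. e ! k \<in> X k)}"

definition remove_edge :: "(nat \<Rightarrow> 'v set) \<Rightarrow> 'v list \<Rightarrow> nat \<Rightarrow> 'v set" where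
  "remove_edge X e = (\<lambda>k. X k - {e ! k})"

lemma finite_edges:
  assumes "\<And>k. k < d \<Longrightarrow> finite (X k)"
  shows "finite (edges d X)"
proof (rule finite_subset)
  show "edges d X \<subseteq> {e. set e \<subseteq> (\<Union>k<d. X k) \<and> length e = d}"
    by (fastforce simp: edges_def in_set_conv_nth)
  show "finite {e. set e \<subseteq> (\<Union>k<d. X k) \<and> length e = d}"
    by (intro finite_lists_length_eq) (use assms in auto)
qed

lemma matchings_subset_Pow_edges: "matchings d X \<subseteq> Pow (edges d X)"
  by (auto simp: matchings_def edges_def bij_betw_def)

lemma finite_matchings:
  "(\<And>k. k < d \<Longrightarrow> finite (X k)) \<Longrightarrow> finite (matchings d X)"
  by (rule finite_subset[OF matchings_subset_Pow_edges]) (simp add: finite_edges)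

lemma matching_sum_empty:
  assumes "d > 0" "\<And>k. k < d \<Longrightarrow> X k = {}"
  shows "matching_sum d X A = 1"
proof -
  have "matchings d X = {{}}"
    using assms by (auto simp: matchings_def bij_betw_def)
  then show ?thesis by (simp add: matching_sum_def)
qed

lemma matching_insert_edge:
  assumes "d > 0" "e \<in> edges d X" "M \<in> matchings d (remove_edge X e)"
  shows "e \<notin> M" "insert e M \<in> matchings d X"
proof -
  have M: "length f = d" if "f \<in> M" for f using assms that by (auto simp: matchings_def)
  have bij: "bij_betw (\<lambda>f. f ! k) M (X k - {e ! k})" if "k < d" for k
    using assms that by (auto simp: matchings_def remove_edge_def)
  show "e \<notin> M"
    using bij[OF assms(1)] by (auto simp: bij_betw_def)
  then have "bij_betw (\<lambda>f. f ! k) (M \<union> {e}) ((X k - {e ! k}) \<union> {e ! k})" if "k < d" for k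
    using notIn_Un_bij_betw[of e M "\<lambda>f. f ! k" "X k - {e ! k}"] bij[OF that] by simp
  moreover have "(X k - {e ! k}) \<union> {e ! k} = X k" if "k < d" for k
    using assms that by (auto simp: edges_def)
  ultimately show "insert e M \<in> matchings d X"
    using M assms(2) by (auto simp: matchings_def edges_def)
qed

lemma matching_remove_edge:
  assumes "M \<in> matchings d X" "e \<in> M"
  shows "M - {e} \<in> matchings d (remove_edge X e)"
proof -
  have "bij_betw (\<lambda>f. f ! k) (M - {e}) (X k - {e ! k})" if "k < d" for k
    using assms that by (intro bij_betw_DiffI) (auto simp: matchings_def bij_betw_def)
  then show ?thesis
    using assms by (auto simp: matchings_def remove_edge_def)
qed

text \<open>
  Laplace expansion along the slice \<open>s\<close> in direction \<open>j\<close>: a perfect matching contains exactly one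
  edge through the vertex \<open>s\<close>, and the rest of it is a perfect matching of the remaining vertices.
\<close>

lemma matching_sum_expand:
  assumes fin: "\<And>k. k < d \<Longrightarrow> finite (X k)" and j: "j < d" and s: "s \<in> X j"
  shows "matching_sum d X A =
    (\<Sum>e \<in> {e \<in> edges d X. e ! j = s}. A e * matching_sum d (remove_edge X e) A)"
proof -
  let ?E = "{e \<in> edges d X. e ! j = s}"
  let ?S = "SIGMA e:?E. matchings d (remove_edge X e)"
  define c where "c M = (THE e. e \<in> M \<and> e ! j = s)" for M
  have c: "c M = e" if "M \<in> matchings d X" "e \<in> M" "e ! j = s" for M e
    unfolding c_def using that j
    by (intro the_equality) (auto simp: matchings_def bij_betw_def dest: inj_onD)
  have ex: "\<exists>e\<in>M. e ! j = s" if "M \<in> matchings d X" for M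
  proof -
    have "s \<in> (\<lambda>e. e ! j) ` M" using that j s by (simp add: matchings_def bij_betw_def)
    then show ?thesis by blast
  qed
  have fin_M: "finite M" if "M \<in> matchings d X" for M
    using that matchings_subset_Pow_edges[of d X] finite_edges[of d X, OF fin]
    by (auto intro: finite_subset)
  have "matching_sum d X A = (\<Sum>(e, M) \<in> ?S. A e * (\<Prod>f\<in>M. A f))"
    unfolding matching_sum_def
  proof (rule sum.reindex_bij_witness[where i = "\<lambda>(e, M). insert e M" and j = "\<lambda>M. (c M, M - {c M})"])
    fix M assume M: "M \<in> matchings d X"
    then obtain e where e: "e \<in> M" "e ! j = s" using ex by blast
    have ce: "c M = e" using c[OF M e] .
    show "(case (c M, M - {c M}) of (e, M) \<Rightarrow> insert e M) = M" using ce e by auto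
    show "(c M, M - {c M}) \<in> ?S"
      using ce e M matching_remove_edge[OF M e(1)] matchings_subset_Pow_edges[of d X] by auto
    show "(case (c M, M - {c M}) of (e, M) \<Rightarrow> A e * (\<Prod>f\<in>M. A f)) = (\<Prod>e\<in>M. A e)"
      using ce e fin_M[OF M] by (simp add: prod.remove[of M e])
  next
    fix eM assume "eM \<in> ?S"
    then obtain e M where eM: "eM = (e, M)" "e \<in> edges d X" "e ! j = s"
      "M \<in> matchings d (remove_edge X e)" by auto
    note ins = matching_insert_edge[OF _ eM(2,4)]
    have "c (insert e M) = e" using c ins j eM by auto
    then show "(c (case eM of (e, M) \<Rightarrow> insert e M),
        (case eM of (e, M) \<Rightarrow> insert e M) - {c (case eM of (e, M) \<Rightarrow> insert e M)}) = eM"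
      using eM ins j by auto
    show "(case eM of (e, M) \<Rightarrow> insert e M) \<in> matchings d X" using eM ins j by auto
  qed
  also have "\<dots> = (\<Sum>e\<in>?E. \<Sum>M \<in> matchings d (remove_edge X e). A e * (\<Prod>f\<in>M. A f))"
  proof (rule sum.Sigma[symmetric])
    show "finite ?E" using finite_edges[of d X, OF fin] by simp
    show "\<forall>e\<in>?E. finite (matchings d (remove_edge X e))"
      using fin by (simp add: finite_matchings remove_edge_def)
  qed
  finally show ?thesis
    by (simp add: matching_sum_def sum_distrib_left)
qed

text \<open>
  The permutations \<open>\<sigma>\<^sub>2, ..., \<sigma>\<^sub>d\<close> correspond to the matching with the edges
  \<open>(i, \<sigma>\<^sub>2 i, ..., \<sigma>\<^sub>d i)\<close>.
\<close>

lemma PER_eq_matching_sum: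
  assumes "d \<ge> 1"
  shows "PER d n A = matching_sum d (\<lambda>_. {1..n}) A"
proof -
  let ?P = "{ss. length ss = d - 1 \<and> set ss \<subseteq> {\<sigma>. \<sigma> permutes {1..n}}}"
  define e where "e ss i = i # map (\<lambda>\<sigma>. \<sigma> i) ss" for ss :: "(nat \<Rightarrow> nat) list" and i
  define F where "F ss = e ss ` {1..n}" for ss
  have inj_e: "inj_on (e ss) {1..n}" for ss by (auto simp: inj_on_def e_def)
  have "bij_betw F ?P (matchings d (\<lambda>_. {1..n}))"
    unfolding bij_betw_def
  proof (intro conjI subset_antisym subsetI)
    show "inj_on F ?P"
    proof (rule inj_onI)
      fix ss ss' assume ss: "ss \<in> ?P" "ss' \<in> ?P" and eq: "F ss = F ss'"
      have ee: "e ss i = e ss' i" if i: "i \<in> {1..n}" for i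
      proof -
        have "e ss i \<in> F ss'" using i eq by (auto simp: F_def)
        then obtain i' where "e ss i = e ss' i'" by (auto simp: F_def)
        then show ?thesis by (auto simp: e_def)
      qed
      show "ss = ss'"
      proof (rule nth_equalityI)
        show len: "length ss = length ss'" using ss by simp
        fix k assume k: "k < length ss"
        then have p: "(ss ! k) permutes {1..n}" "(ss' ! k) permutes {1..n}"
          using ss len by (metis (no_types, lifting) mem_Collect_eq nth_mem subsetD)+
        show "ss ! k = ss' ! k"
        proof
          fix i
          show "(ss ! k) i = (ss' ! k) i"
          proof (cases "i \<in> {1..n}")
            case True
            then have "map (\<lambda>\<sigma>. \<sigma> i) ss ! k = map (\<lambda>\<sigma>. \<sigma> i) ss' ! k"
              using ee by (simp add: e_def)
            then show ?thesis using k len by simp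
          next
            case False
            then show ?thesis using p by (simp add: permutes_not_in)
          qed
        qed
      qed
    qed
  next
    fix M assume "M \<in> F ` ?P"
    then obtain ss where ss: "length ss = d - 1" "set ss \<subseteq> {\<sigma>. \<sigma> permutes {1..n}}" "M = F ss"
      by auto
    have "bij_betw (\<lambda>f. f ! k) M {1..n}" if "k < d" for k
    proof -
      have "bij_betw (\<lambda>i. e ss i ! k) {1..n} {1..n}"
      proof (cases k)
        case 0
        then show ?thesis by (auto simp: e_def bij_betw_def)
      next
        case (Suc k')
        then have "k' < length ss" using that ss by simp
        then have "(ss ! k') permutes {1..n}"
          using ss(2) by (metis (no_types, lifting) mem_Collect_eq nth_mem subsetD)
        with Suc \<open>k' < length ss\<close> show ?thesis
          by (simp add: e_def permutes_imp_bij)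
      qed
      moreover have "bij_betw (e ss) {1..n} M"
        using inj_e[of ss] by (simp add: bij_betw_def ss(3) F_def)
      ultimately show ?thesis
        using bij_betw_comp_iff[of "e ss" "{1..n}" M "\<lambda>f. f ! k" "{1..n}"] by (simp add: o_def)
    qed
    then show "M \<in> matchings d (\<lambda>_. {1..n})"
      using ss assms by (auto simp: matchings_def F_def e_def)
  next
    fix M assume M: "M \<in> matchings d (\<lambda>_. {1..n})"
    \<comment> \<open>An edge of \<open>M\<close> is recovered from its first vertex; the permutations are read off from its
        other vertices and extended by the identity outside \<open>{1..n}\<close>.\<close>
    define g where "g = the_inv_into M (\<lambda>f. f ! 0)"
    have b0: "bij_betw (\<lambda>f. f ! 0) M {1..n}" using M assms by (auto simp: matchings_def)
    have g: "bij_betw g {1..n} M" unfolding g_def using b0 by (rule bij_betw_the_inv_into)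
    have g0: "g i ! 0 = i" if "i \<in> {1..n}" for i
      unfolding g_def by (rule f_the_inv_into_f_bij_betw[OF b0]) (rule that)
    define \<sigma> where "\<sigma> k i = (if i \<in> {1..n} then g i ! Suc k else i)" for k i
    define ss where "ss = map \<sigma> [0..<d-1]"
    have perm: "\<sigma> k permutes {1..n}" if "k < d - 1" for k
    proof (rule bij_imp_permutes)
      have "bij_betw (\<lambda>f. f ! Suc k) M {1..n}" using M that by (auto simp: matchings_def)
      then have "bij_betw ((\<lambda>f. f ! Suc k) \<circ> g) {1..n} {1..n}" using g by (rule bij_betw_trans[rotated])
      then show "bij_betw (\<sigma> k) {1..n} {1..n}"
        by (rule iffD1[OF bij_betw_cong, rotated]) (auto simp: \<sigma>_def)
    qed (auto simp: \<sigma>_def)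
    have "e ss i = g i" if i: "i \<in> {1..n}" for i
    proof (rule nth_equalityI)
      have "g i \<in> M" using g i by (auto simp: bij_betw_def)
      then show len: "length (e ss i) = length (g i)"
        using M assms by (auto simp: matchings_def e_def ss_def)
      fix k assume "k < length (e ss i)"
      then show "e ss i ! k = g i ! k"
        using g0[OF i] i by (cases k) (auto simp: e_def ss_def \<sigma>_def)
    qed
    then have "F ss = M" using g by (simp add: F_def bij_betw_def)
    moreover have "ss \<in> ?P" using perm by (auto simp: ss_def)
    ultimately show "M \<in> F ` ?P" by blast
  qed
  then have "matching_sum d (\<lambda>_. {1..n}) A = (\<Sum>ss\<in>?P. \<Prod>f\<in>F ss. A f)"
    unfolding matching_sum_def by (rule sum.reindex_bij_betw[symmetric])
  also have "\<dots> = PER d n A"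
    unfolding PER_def F_def by (intro sum.cong refl) (simp only: prod.reindex[OF inj_e] o_def e_def)
  finally show ?thesis ..
qed

lemma tensor_indices_eq_edges: "tensor_indices d n = edges d (\<lambda>_. {1..n})"
  unfolding tensor_indices_def edges_def
  by (auto simp: in_set_conv_nth subset_iff)

lemma matching_sum_cong:
  assumes "\<And>e. e \<in> edges d X \<Longrightarrow> A e = B e"
  shows "matching_sum d X A = matching_sum d X B"
  unfolding matching_sum_def
  using assms matchings_subset_Pow_edges[of d X] by (intro sum.cong prod.cong) blast+

lemma norm_matching_sum_le:
  fixes A :: "'v list \<Rightarrow> complex"
  assumes "d \<ge> 1" "card (X 0) = n" "\<And>e. e \<in> edges d X \<Longrightarrow> norm (A e) \<le> c"
  shows "norm (matching_sum d X A) \<le> real (card (matchings d X)) * c ^ n"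
proof -
  have "norm (\<Prod>e\<in>M. A e) \<le> c ^ n" if M: "M \<in> matchings d X" for M
  proof -
    have "card M = n"
      using M assms(1,2) by (auto simp: matchings_def dest: bij_betw_same_card)
    have "norm (\<Prod>e\<in>M. A e) = (\<Prod>e\<in>M. norm (A e))" by (rule prod_norm[symmetric])
    also have "\<dots> \<le> (\<Prod>e\<in>M. c)"
      using M matchings_subset_Pow_edges[of d X] assms(3) by (intro prod_mono) auto
    finally show ?thesis using \<open>card M = n\<close> by simp
  qed
  then show ?thesis
    unfolding matching_sum_def by (rule sum_norm_bound)
qed

section \<open>Angles between weighted sums of plane vectors\<close>

text \<open>
  The square of the norm of a real combination is a quadratic form in the weights whose coefficients
  are the inner products of the vectors. As these are nonnegative, the form is monotone in the
  absolute values of the weights.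
\<close>

lemma norm_weighted_sum_le:
  fixes u :: "'i \<Rightarrow> complex" and \<alpha> \<beta> :: "'i \<Rightarrow> real"
  assumes u: "\<And>e f. e \<in> E \<Longrightarrow> f \<in> E \<Longrightarrow> 0 \<le> Re (u e * cnj (u f))"
    and \<alpha>\<beta>: "\<And>e. e \<in> E \<Longrightarrow> \<bar>\<beta> e\<bar> \<le> c * \<alpha> e" and "c \<ge> 0"
  shows "norm (\<Sum>e\<in>E. of_real (\<beta> e) * u e) \<le> c * norm (\<Sum>e\<in>E. of_real (\<alpha> e) * u e)"
proof -
  have sq: "(norm (\<Sum>e\<in>E. of_real (w e) * u e))\<^sup>2 =
      (\<Sum>e\<in>E. \<Sum>f\<in>E. w e * w f * Re (u e * cnj (u f)))" for w :: "'i \<Rightarrow> real"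
  proof -
    have "complex_of_real ((norm (\<Sum>e\<in>E. of_real (w e) * u e))\<^sup>2) =
      (\<Sum>e\<in>E. \<Sum>f\<in>E. of_real (w e) * u e * (of_real (w f) * cnj (u f)))"
      by (simp only: complex_norm_square) (simp add: sum_product)
    from arg_cong[OF this, of Re] show ?thesis
      by (simp add: algebra_simps)
  qed
  have "(norm (\<Sum>e\<in>E. of_real (\<beta> e) * u e))\<^sup>2 \<le>
      (\<Sum>e\<in>E. \<Sum>f\<in>E. (c * \<alpha> e) * (c * \<alpha> f) * Re (u e * cnj (u f)))"
    unfolding sq
  proof (intro sum_mono mult_right_mono)
    fix e f assume ef: "e \<in> E" "f \<in> E"
    have "\<beta> e * \<beta> f \<le> \<bar>\<beta> e\<bar> * \<bar>\<beta> f\<bar>" by (metis abs_ge_self abs_mult)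
    also have "\<dots> \<le> (c * \<alpha> e) * (c * \<alpha> f)"
      using \<alpha>\<beta>[OF ef(1)] \<alpha>\<beta>[OF ef(2)] by (intro mult_mono) auto
    finally show "\<beta> e * \<beta> f \<le> (c * \<alpha> e) * (c * \<alpha> f)" .
  qed (use u in auto)
  also have "\<dots> = (c * norm (\<Sum>e\<in>E. of_real (\<alpha> e) * u e))\<^sup>2"
    unfolding power_mult_distrib sq by (simp add: sum_distrib_left power2_eq_square mult_ac)
  finally show ?thesis
    by (rule power2_le_imp_le) (use \<open>c \<ge> 0\<close> in auto)
qed

text \<open>
  The argument has tangent \<open>2 * Im q / (1 - |q|^2)\<close>, which in the disc of radius \<open>\<kappa>\<close> is extremal at
  \<open>q = \<plusminus> i \<kappa>\<close>, where the double angle formula applies.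
\<close>

lemma abs_Arg_Cayley_le:
  fixes q :: complex
  assumes "norm q \<le> \<kappa>" "\<kappa> < 1"
  shows "\<bar>Arg ((1 + q) / (1 - q))\<bar> \<le> 2 * arctan \<kappa>"
proof -
  define w where "w = (1 + q) / (1 - q)"
  have k0: "0 \<le> \<kappa>" using assms norm_ge_zero order_trans by blast
  have q1: "(norm q)\<^sup>2 \<le> \<kappa>\<^sup>2" using assms by (intro power_mono) auto
  have k1: "\<kappa>\<^sup>2 < 1" using k0 assms by (simp add: power_less_one_iff abs_square_less_1)
  have "q \<noteq> 1" using assms by auto
  then have D: "(norm (1 - q))\<^sup>2 > 0" by simp
  have num: "(1 + q) * cnj (1 - q) = Complex (1 - (norm q)\<^sup>2) (2 * Im q)"
    unfolding complex_eq_iff cmod_power2 by (simp add: power2_eq_square algebra_simps)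
  have w: "w = ((1 + q) * cnj (1 - q)) / of_real ((norm (1 - q))\<^sup>2)"
    unfolding w_def by (subst complex_div_cnj) simp
  have Re_w: "Re w = (1 - (norm q)\<^sup>2) / (norm (1 - q))\<^sup>2"
    unfolding w num by (simp add: Re_divide_of_real)
  have Im_w: "Im w = 2 * Im q / (norm (1 - q))\<^sup>2"
    unfolding w num by (simp add: Im_divide_of_real)
  have pos: "Re w > 0" unfolding Re_w using D q1 k1 by auto
  have "\<bar>Im w / Re w\<bar> = 2 * \<bar>Im q\<bar> / (1 - (norm q)\<^sup>2)"
    unfolding Re_w Im_w using D q1 k1 by (simp add: abs_mult)
  also have "\<dots> \<le> 2 * \<kappa> / (1 - \<kappa>\<^sup>2)"
    using abs_Im_le_cmod[of q] assms(1) q1 k1 k0 by (intro frac_le) auto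
  also have "\<dots> = tan (2 * arctan \<kappa>)"
  proof -
    have "tan (2 * arctan \<kappa>) = 2 * tan (arctan \<kappa>) / (1 - (tan (arctan \<kappa>))\<^sup>2)"
    proof (rule tan_double)
      show "cos (2 * arctan \<kappa>) \<noteq> 0"
      proof -
        have "\<bar>arctan \<kappa>\<bar> < pi / 4" using k0 assms arctan_less_iff[of \<kappa> 1]
          by (simp add: arctan_one zero_le_arctan_iff)
        then have "cos (2 * arctan \<kappa>) > 0" by (intro cos_gt_zero_pi) auto
        then show ?thesis by simp
      qed
    qed simp
    then show ?thesis by (simp add: tan_arctan)
  qed
  finally have le: "\<bar>Im w / Re w\<bar> \<le> tan (2 * arctan \<kappa>)" .
  have "0 \<le> arctan \<kappa>" "arctan \<kappa> < pi / 4"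
    using k0 assms arctan_less_iff[of \<kappa> 1] by (auto simp: arctan_one)
  then have "- (pi / 2) < 2 * arctan \<kappa>" "2 * arctan \<kappa> < pi / 2"
    using pi_gt_zero by linarith+
  then have inv: "arctan (tan (2 * arctan \<kappa>)) = 2 * arctan \<kappa>"
    by (rule arctan_tan)
  have "\<bar>arctan (Im w / Re w)\<bar> = arctan \<bar>Im w / Re w\<bar>"
    by (simp add: abs_if arctan_minus)
  also have "\<dots> \<le> 2 * arctan \<kappa>"
    using arctan_monotone'[OF le] inv by simp
  finally show ?thesis
    using pos by (simp add: arg_conv_arctan w_def)
qed

lemma Re_mult_cnj_nonneg:
  assumes "v \<noteq> 0" "\<bar>Arg (u / v)\<bar> \<le> pi / 2"
  shows "0 \<le> Re (u * cnj v)"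
proof -
  define z where "z = u / v"
  have "u * cnj v = z * of_real ((norm v)\<^sup>2)"
    unfolding z_def using assms by (simp only: complex_norm_square) simp
  then have "Re (u * cnj v) = Re z * (norm v)\<^sup>2" by simp
  moreover have "0 \<le> Re z" using assms(2) by (simp only: z_def Arg_Re_nonneg)
  ultimately show ?thesis by simp
qed

lemma abs_Arg_divide_trans:
  assumes "u \<noteq> 0" "v \<noteq> 0" "w \<noteq> 0"
    and "\<bar>Arg (u / v)\<bar> \<le> \<alpha>" "\<bar>Arg (v / w)\<bar> \<le> \<beta>" "\<alpha> + \<beta> < pi"
  shows "\<bar>Arg (u / w)\<bar> \<le> \<alpha> + \<beta>"
proof -
  have "u / w = (u / v) * (v / w)" using assms by simp
  moreover have "Arg ((u / v) * (v / w)) = Arg (u / v) + Arg (v / w)"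
    using assms by (intro Arg_times) auto
  ultimately show ?thesis using assms by simp
qed

text \<open>
  Real parts in the box are at least \<open>1 - \<eta>\<close>, so the imaginary parts are scaled such that \<open>\<tau>\<close> bounds
  the ratio of the imaginary to the real part.
\<close>

definition entry_box :: "real \<Rightarrow> real \<Rightarrow> complex set" where
  "entry_box \<eta> \<tau> = {a. \<bar>1 - Re a\<bar> \<le> \<eta> \<and> \<bar>Im a\<bar> \<le> \<tau> * (1 - \<eta>)}"

text \<open>
  Let \<open>x\<close> and \<open>y\<close> be half the sum and half the difference of the weights \<open>a\<close> and \<open>b\<close>. The two
  weighted sums are \<open>X + Y\<close> and \<open>X - Y\<close>, where \<open>X\<close> and \<open>Y\<close> are the sums with weights \<open>x\<close> and \<open>y\<close>, and their
  quotient is \<open>(1 + q) / (1 - q)\<close> with \<open>q = Y / X\<close>. For real weights \<open>|y| \<le> \<eta> x\<close> holds termwise and hence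
  \<open>|Y| \<le> \<eta> |X|\<close>, because the vectors \<open>u\<close> have nonnegative inner products. The imaginary
  parts of the weights perturb both sides by at most \<open>\<tau>\<close> times the norm of the sum with weights \<open>Re x\<close>,
  which is what the gap between \<open>\<eta>\<close> and \<open>\<kappa>\<close> pays for.
\<close>

lemma abs_Arg_weighted_sums:
  fixes u a b :: "'i \<Rightarrow> complex"
  assumes E: "finite E" "E \<noteq> {}"
    and u: "\<And>e. e \<in> E \<Longrightarrow> u e \<noteq> 0"
           "\<And>e f. e \<in> E \<Longrightarrow> f \<in> E \<Longrightarrow> 0 \<le> Re (u e * cnj (u f))"
    and ab: "\<And>e. e \<in> E \<Longrightarrow> a e \<in> entry_box \<eta> \<tau>" "\<And>e. e \<in> E \<Longrightarrow> b e \<in> entry_box \<eta> \<tau>"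
    and par: "0 \<le> \<eta>" "\<eta> < 1" "0 \<le> \<tau>" "\<eta> + \<tau> \<le> \<kappa> * (1 - \<tau>)" "\<tau> < 1" "\<kappa> < 1"
  shows "(\<Sum>e\<in>E. a e * u e) \<noteq> 0"
    and "\<bar>Arg ((\<Sum>e\<in>E. a e * u e) / (\<Sum>e\<in>E. b e * u e))\<bar> \<le> 2 * arctan \<kappa>"
proof -
  define x where "x e = (a e + b e) / 2" for e
  define y where "y e = (a e - b e) / 2" for e
  define S where "S w = (\<Sum>e\<in>E. w e * u e)" for w
  have S_add: "S (\<lambda>e. v e + w e) = S v + S w" for v w
    by (simp add: S_def sum.distrib algebra_simps)
  have S_diff: "S (\<lambda>e. v e - w e) = S v - S w" for v w
    by (simp add: S_def sum_subtractf algebra_simps)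
  have split: "S w = S (\<lambda>e. of_real (Re (w e))) + \<i> * S (\<lambda>e. of_real (Im (w e)))" for w
  proof -
    have "S w = S (\<lambda>e. of_real (Re (w e)) + \<i> * of_real (Im (w e)))"
      by (simp add: complex_eq[symmetric])
    then show ?thesis by (simp add: S_add) (simp add: S_def sum_distrib_left mult_ac)
  qed
  define XR where "XR = S (\<lambda>e. of_real (Re (x e)))"
  have Rex: "1 - \<eta> \<le> Re (x e)" if "e \<in> E" for e
    using ab[OF that] by (auto simp: x_def entry_box_def)
  have Xpos: "norm XR > 0"
  proof -
    obtain e where e: "e \<in> E" using E by blast
    \<comment> \<open>The sum dominates each single vector, since the indicator weight of \<open>e\<close> is at most
        \<open>Re x / (1 - \<eta>)\<close>.\<close>
    have "norm (S (\<lambda>f. of_real (of_bool (f = e)))) \<le> 1 / (1 - \<eta>) * norm XR"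
      unfolding S_def XR_def
    proof (rule norm_weighted_sum_le)
      fix f assume f: "f \<in> E"
      show "\<bar>of_bool (f = e)\<bar> \<le> 1 / (1 - \<eta>) * Re (x f)"
        using Rex[OF f] par by (auto simp: field_simps)
    qed (use u par in auto)
    moreover have "S (\<lambda>f. of_real (of_bool (f = e))) = (\<Sum>f\<in>E. if f = e then u f else 0)"
      unfolding S_def by (intro sum.cong) auto
    then have "S (\<lambda>f. of_real (of_bool (f = e))) = u e"
      using E e by simp
    moreover have "norm (u e) > 0" using u e by simp
    ultimately have "0 < 1 / (1 - \<eta>) * norm XR" by (metis less_le_trans)
    then show ?thesis by (auto simp: zero_less_mult_iff)
  qed
  have XI: "norm (S (\<lambda>e. of_real (Im (x e)))) \<le> \<tau> * norm XR"
    unfolding S_def XR_def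
  proof (rule norm_weighted_sum_le)
    fix e assume e: "e \<in> E"
    have "\<bar>Im (x e)\<bar> \<le> \<tau> * (1 - \<eta>)" using ab[OF e] by (auto simp: x_def entry_box_def)
    also have "\<dots> \<le> \<tau> * Re (x e)" using Rex[OF e] par by (intro mult_left_mono) auto
    finally show "\<bar>Im (x e)\<bar> \<le> \<tau> * Re (x e)" .
  qed (use u par in auto)
  have YI: "norm (S (\<lambda>e. of_real (Im (y e)))) \<le> \<tau> * norm XR"
    unfolding S_def XR_def
  proof (rule norm_weighted_sum_le)
    fix e assume e: "e \<in> E"
    have "\<bar>Im (y e)\<bar> \<le> \<tau> * (1 - \<eta>)" using ab[OF e] by (auto simp: y_def entry_box_def)
    also have "\<dots> \<le> \<tau> * Re (x e)" using Rex[OF e] par by (intro mult_left_mono) auto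
    finally show "\<bar>Im (y e)\<bar> \<le> \<tau> * Re (x e)" .
  qed (use u par in auto)
  have YR: "norm (S (\<lambda>e. of_real (Re (y e)))) \<le> \<eta> * norm XR"
    unfolding S_def XR_def
  proof (rule norm_weighted_sum_le)
    fix e assume e: "e \<in> E"
    define s t where "s = Re (a e) - 1" and "t = Re (b e) - 1"
    have st: "\<bar>s\<bar> \<le> \<eta>" "\<bar>t\<bar> \<le> \<eta>" using ab[OF e] by (auto simp: s_def t_def entry_box_def)
    have "\<bar>s - t\<bar> \<le> \<eta> * (2 + s + t)"
    proof -
      have "0 \<le> (1 - \<eta>) * (\<eta> - s) + (1 + \<eta>) * (\<eta> + t)"
           "0 \<le> (1 - \<eta>) * (\<eta> - t) + (1 + \<eta>) * (\<eta> + s)"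
        using st par by (auto intro!: add_nonneg_nonneg mult_nonneg_nonneg)
      then show ?thesis by (simp add: algebra_simps abs_le_iff)
    qed
    then show "\<bar>Re (y e)\<bar> \<le> \<eta> * Re (x e)"
      by (simp add: x_def y_def s_def t_def algebra_simps)
  qed (use u par in auto)
  have "norm (S y) \<le> norm (S (\<lambda>e. of_real (Re (y e)))) + norm (\<i> * S (\<lambda>e. of_real (Im (y e))))"
    unfolding split[of y] by (rule norm_triangle_ineq)
  then have Y_le: "norm (S y) \<le> (\<eta> + \<tau>) * norm XR"
    using YR YI unfolding norm_mult distrib_right by simp
  have "norm XR - norm (\<i> * S (\<lambda>e. of_real (Im (x e)))) \<le> norm (S x)"
    unfolding split[of x] XR_def by (rule norm_diff_ineq)
  then have X_ge: "(1 - \<tau>) * norm XR \<le> norm (S x)"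
    using XI unfolding norm_mult left_diff_distrib by simp
  have "0 < (1 - \<tau>) * norm XR" using Xpos par by simp
  then have X0: "norm (S x) > 0" using X_ge by linarith
  have k0: "0 \<le> \<kappa>"
  proof (rule ccontr)
    assume "\<not> 0 \<le> \<kappa>"
    then have "\<kappa> * (1 - \<tau>) < 0" using par by (simp add: mult_less_0_iff)
    then show False using par by linarith
  qed
  have YX: "norm (S y) \<le> \<kappa> * norm (S x)"
  proof -
    have "norm (S y) \<le> \<kappa> * (1 - \<tau>) * norm XR"
      using Y_le par(4) Xpos by (meson less_eq_real_def mult_right_mono order_trans)
    also have "\<dots> \<le> \<kappa> * norm (S x)" using X_ge k0 by (simp add: mult.assoc mult_left_mono)
    finally show ?thesis .
  qed
  define q where "q = S y / S x"
  have q: "norm q \<le> \<kappa>" using YX X0 by (simp add: q_def norm_divide field_simps)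
  have Sy: "S y = q * S x" using X0 by (simp add: q_def)
  have "a = (\<lambda>e. x e + y e)" by (auto simp: x_def y_def field_simps)
  then have Sa: "S a = S x * (1 + q)"
    using S_add[of x y] Sy by (simp add: algebra_simps)
  have "b = (\<lambda>e. x e - y e)" by (auto simp: x_def y_def field_simps)
  then have Sb: "S b = S x * (1 - q)"
    using S_diff[of x y] Sy by (simp add: algebra_simps)
  have "1 + q \<noteq> 0"
  proof
    assume "1 + q = 0"
    then have "q = - 1" by (simp add: add_eq_0_iff)
    then show False using q par by simp
  qed
  then show "(\<Sum>e\<in>E. a e * u e) \<noteq> 0" using Sa X0 by (auto simp: S_def)
  have "S a / S b = (1 + q) / (1 - q)" using Sa Sb X0 by simp
  then show "\<bar>Arg ((\<Sum>e\<in>E. a e * u e) / (\<Sum>e\<in>E. b e * u e))\<bar> \<le> 2 * arctan \<kappa>"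
    using abs_Arg_Cayley_le[OF q par(6)] by (simp add: S_def)
qed

section \<open>A zero-free region for the permanent\<close>

text \<open>
  Edges that differ in a single vertex leave minors that differ in a single slice.
\<close>

lemma remove_edge_update:
  assumes "e ! k \<in> X k" "f ! k \<in> X k" "e ! k \<noteq> f ! k" "k < length e"
  shows "remove_edge X (e[k := f ! k]) =
    (remove_edge X e)(k := insert (e ! k) (remove_edge X e k - {f ! k}))"
  using assms by (auto simp: remove_edge_def fun_eq_iff nth_list_update)

definition swap_vertex :: "(nat \<Rightarrow> 'v set) \<Rightarrow> nat \<Rightarrow> 'v \<Rightarrow> 'v \<Rightarrow> nat \<Rightarrow> 'v set" where
  "swap_vertex X j s t = X(j := insert t (X j - {s}))"

text \<open>
  The two claims are proved together by induction on the size of the parts. In the expansion along a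
  slice, the minors are nonzero and differ from one another in at most \<open>d - 1\<close> slices, because
  all edges involved share a vertex; by the induction hypothesis the angle between two of
  them is at most \<open>(d - 1) * 2 arctan \<kappa>\<close>, hence at most \<open>pi/2\<close>. So the expansion is
  a weighted sum of vectors with nonnegative inner products. Swapping the vertex \<open>s\<close> for a new
  vertex \<open>t\<close> keeps the minors and changes only the weights, and \<open>abs_Arg_weighted_sums\<close> gives both
  claims.
\<close>

lemma matching_sum_nonzero_and_angle:
  fixes A :: "'v list \<Rightarrow> complex"
  assumes A: "\<And>e. A e \<in> entry_box \<eta> \<tau>"
    and d: "d \<ge> 2"
    and par: "0 \<le> \<eta>" "\<eta> < 1" "0 \<le> \<tau>" "\<eta> + \<tau> \<le> \<kappa> * (1 - \<tau>)" "\<tau> < 1" "\<kappa> < 1"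
    and angle: "(real d - 1) * (2 * arctan \<kappa>) \<le> pi / 2"
    and X: "\<And>k. k < d \<Longrightarrow> finite (X k) \<and> card (X k) = n"
  shows "matching_sum d X A \<noteq> 0 \<and>
    (\<forall>j<d. \<forall>s\<in>X j. \<forall>t. t \<notin> X j \<longrightarrow>
       \<bar>Arg (matching_sum d X A / matching_sum d (swap_vertex X j s t) A)\<bar> \<le> 2 * arctan \<kappa>)"
  using X
proof (induction n arbitrary: X)
  case 0
  then have "\<And>k. k < d \<Longrightarrow> X k = {}" by (metis card_0_eq)
  then show ?case using matching_sum_empty[of d X A] d by auto
next
  case (Suc n)
  let ?P = "\<lambda>X. matching_sum d X A"
  let ?\<psi> = "2 * arctan \<kappa>"
  have k0: "0 \<le> \<kappa>"
  proof (rule ccontr)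
    assume "\<not> 0 \<le> \<kappa>"
    then have "\<kappa> * (1 - \<tau>) < 0" using par by (simp add: mult_less_0_iff)
    then show False using par by linarith
  qed
  then have psi0: "0 \<le> ?\<psi>" by simp
  have sub: "\<And>k. k < d \<Longrightarrow> finite (remove_edge X e k) \<and> card (remove_edge X e k) = n"
    if "e \<in> edges d X" for e
    using that Suc.prems by (auto simp: edges_def remove_edge_def)
  have nz: "?P (remove_edge X e) \<noteq> 0" if "e \<in> edges d X" for e
    using Suc.IH[of "remove_edge X e", OF sub[OF that]] by blast
  note IH_swap = Suc.IH
  \<comment> \<open>The edge \<open>e\<close> is turned into \<open>f\<close> one vertex at a time. Restricting the number of steps to
      \<open>d - 1\<close> keeps the accumulated angle below \<open>pi\<close>, where arguments of products add up.\<close>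
  have path: "\<bar>Arg (?P (remove_edge X e) / ?P (remove_edge X f))\<bar> \<le> real m * ?\<psi>"
    if "e \<in> edges d X" "f \<in> edges d X" "card {k. k < d \<and> e ! k \<noteq> f ! k} = m" "m \<le> d - 1" for e f m
    using that
  proof (induction m arbitrary: e)
    case 0
    then have "e = f" by (auto simp: edges_def intro!: nth_equalityI)
    then show ?case using nz[OF 0(2)] by simp
  next
    case (Suc m)
    then have "{k. k < d \<and> e ! k \<noteq> f ! k} \<noteq> {}" by force
    then obtain k where k: "k < d" "e ! k \<noteq> f ! k" by blast
    define e' where "e' = e[k := f ! k]"
    have e': "e' \<in> edges d X"
      using Suc.prems k by (auto simp: edges_def e'_def nth_list_update)
    have "{i. i < d \<and> e' ! i \<noteq> f ! i} = {k. k < d \<and> e ! k \<noteq> f ! k} - {k}"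
      using Suc.prems k by (auto simp: edges_def e'_def nth_list_update split: if_splits)
    then have "card {i. i < d \<and> e' ! i \<noteq> f ! i} = m" using Suc.prems k by simp
    then have IH: "\<bar>Arg (?P (remove_edge X e') / ?P (remove_edge X f))\<bar> \<le> real m * ?\<psi>"
      using Suc.IH[OF e'] Suc.prems by simp
    have "remove_edge X e' = swap_vertex (remove_edge X e) k (f ! k) (e ! k)"
      unfolding e'_def swap_vertex_def
      using Suc.prems k by (intro remove_edge_update) (auto simp: edges_def)
    moreover have "f ! k \<in> remove_edge X e k" "e ! k \<notin> remove_edge X e k"
      using Suc.prems k by (auto simp: edges_def remove_edge_def)
    ultimately have step: "\<bar>Arg (?P (remove_edge X e) / ?P (remove_edge X e'))\<bar> \<le> ?\<psi>"
      using IH_swap[of "remove_edge X e", OF sub[OF Suc.prems(1)]] k by metis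
    have "real (Suc m) * ?\<psi> \<le> (real d - 1) * ?\<psi>"
      using Suc.prems d psi0 by (intro mult_right_mono) auto
    moreover have "real (Suc m) * ?\<psi> = ?\<psi> + real m * ?\<psi>"
      by (simp add: algebra_simps)
    ultimately have "?\<psi> + real m * ?\<psi> < pi"
      using angle pi_gt_zero by linarith
    then have "\<bar>Arg (?P (remove_edge X e) / ?P (remove_edge X f))\<bar> \<le> ?\<psi> + real m * ?\<psi>"
      using abs_Arg_divide_trans[OF nz[OF Suc.prems(1)] nz[OF e'] nz[OF Suc.prems(2)] step IH] by simp
    then show ?case by (simp add: algebra_simps)
  qed
  have cone: "0 \<le> Re (?P (remove_edge X e) * cnj (?P (remove_edge X f)))"
    if ef: "e \<in> edges d X" "f \<in> edges d X" and j: "j < d" "e ! j = f ! j" for e f j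
  proof (rule Re_mult_cnj_nonneg)
    let ?D = "{k. k < d \<and> e ! k \<noteq> f ! k}"
    have "?D \<subseteq> {..<d} - {j}" using j by auto
    then have "card ?D \<le> card ({..<d} - {j})" by (intro card_mono) auto
    also have "\<dots> = d - 1" using j by simp
    finally have le: "card ?D \<le> d - 1" .
    have "\<bar>Arg (?P (remove_edge X e) / ?P (remove_edge X f))\<bar> \<le> real (card ?D) * ?\<psi>"
      using path[OF ef refl le] .
    also have "\<dots> \<le> (real d - 1) * ?\<psi>"
      using le d psi0 by (intro mult_right_mono) auto
    finally show "\<bar>Arg (?P (remove_edge X e) / ?P (remove_edge X f))\<bar> \<le> pi / 2"
      using angle by linarith
  qed (rule nz[OF ef(2)])
  let ?E = "\<lambda>j s. {e \<in> edges d X. e ! j = s}"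
  have E: "finite (?E j s)" "?E j s \<noteq> {}" if j: "j < d" and s: "s \<in> X j" for j s
  proof -
    show "finite (?E j s)" using finite_edges[of d X] Suc.prems by simp
    have "\<exists>x. x \<in> X k" if "k < d" for k
      using Suc.prems[OF that] by (metis card.empty ex_in_conv nat.distinct(1))
    then obtain x where x: "\<And>k. k < d \<Longrightarrow> x k \<in> X k" by metis
    have "(map x [0..<d])[j := s] \<in> ?E j s"
      using x j s by (auto simp: edges_def nth_list_update)
    then show "?E j s \<noteq> {}" by blast
  qed
  have expand: "?P X = (\<Sum>e \<in> ?E j s. A e * ?P (remove_edge X e))" if "j < d" "s \<in> X j" for j s
    using Suc.prems that by (intro matching_sum_expand) auto
  have sums: "(\<Sum>e \<in> ?E j s. A e * ?P (remove_edge X e)) \<noteq> 0"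
    "\<bar>Arg ((\<Sum>e \<in> ?E j s. A e * ?P (remove_edge X e)) /
       (\<Sum>e \<in> ?E j s. A (e[j := t]) * ?P (remove_edge X e)))\<bar> \<le> ?\<psi>"
    if j: "j < d" and s: "s \<in> X j" for j s t
    using abs_Arg_weighted_sums[OF E[OF j s], of "\<lambda>e. ?P (remove_edge X e)" A \<eta> \<tau> "\<lambda>e. A (e[j := t])" \<kappa>]
      nz cone[where j = j] A par j by auto
  have swap: "?P (swap_vertex X j s t) = (\<Sum>e \<in> ?E j s. A (e[j := t]) * ?P (remove_edge X e))"
    if j: "j < d" and s: "s \<in> X j" and t: "t \<notin> X j" for j s t
  proof -
    let ?Y = "swap_vertex X j s t"
    have "?P ?Y = (\<Sum>e \<in> {e \<in> edges d ?Y. e ! j = t}. A e * ?P (remove_edge ?Y e))"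
      using Suc.prems j by (intro matching_sum_expand) (auto simp: swap_vertex_def)
    also have "\<dots> = (\<Sum>e \<in> ?E j s. A (e[j := t]) * ?P (remove_edge X e))"
    proof (rule sum.reindex_bij_witness[where i = "\<lambda>e. e[j := t]" and j = "\<lambda>e. e[j := s]"])
      fix e assume "e \<in> {e \<in> edges d ?Y. e ! j = t}"
      then have e: "length e = d" "\<And>k. k < d \<Longrightarrow> e ! k \<in> ?Y k" "e ! j = t" by (auto simp: edges_def)
      have e'': "e[j := s, j := t] = e" using e(3) by (metis list_update_id list_update_overwrite)
      then show "e[j := s, j := t] = e" .
      show "e[j := s] \<in> ?E j s"
        using e j s by (auto simp: edges_def nth_list_update swap_vertex_def split: if_splits)
           (metis fun_upd_other)
      have "remove_edge X (e[j := s]) = remove_edge ?Y e"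
        using e j s t by (auto simp: remove_edge_def fun_eq_iff nth_list_update swap_vertex_def)
      then show "A (e[j := s, j := t]) * ?P (remove_edge X (e[j := s])) = A e * ?P (remove_edge ?Y e)"
        using e'' by simp
    next
      fix e assume "e \<in> ?E j s"
      then have e: "length e = d" "\<And>k. k < d \<Longrightarrow> e ! k \<in> X k" "e ! j = s" by (auto simp: edges_def)
      show "e[j := t, j := s] = e" using e(3) by (metis list_update_id list_update_overwrite)
      show "e[j := t] \<in> {e \<in> edges d ?Y. e ! j = t}"
        using e j by (auto simp: edges_def nth_list_update swap_vertex_def)
    qed
    finally show ?thesis .
  qed
  show ?case
  proof (intro conjI allI impI ballI)
    have "X 0 \<noteq> {}" using Suc.prems[of 0] d by auto
    then obtain s where "s \<in> X 0" by blast
    then show "?P X \<noteq> 0" using sums(1)[of 0 s] expand[of 0 s] d by simp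
  next
    fix j s t assume "j < d" "s \<in> X j" "t \<notin> X j"
    then show "\<bar>Arg (?P X / ?P (swap_vertex X j s t))\<bar> \<le> ?\<psi>"
      using sums(2)[of j s t] expand[of j s] swap[of j s t] by simp
  qed
qed

text \<open>
  The all-ones tensor lies in the zero-free region, and its permanent counts the matchings.
\<close>

lemma card_matchings_pos:
  fixes n :: nat
  assumes d: "d \<ge> 2"
  shows "card (matchings d (\<lambda>_. {1..n})) > 0"
proof -
  have "matching_sum d (\<lambda>_. {1..n}) (\<lambda>_. 1) \<noteq> (0::complex)"
    using matching_sum_nonzero_and_angle[of "\<lambda>_. 1" 0 0 d 0 "\<lambda>_. {1..n}" n] d
    by (simp add: entry_box_def)
  then show ?thesis by (cases "card (matchings d (\<lambda>_. {1..n})) = 0") (auto simp: matching_sum_def)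
qed

text \<open>
  Only here the value of \<open>eta_bound d\<close> matters: it is the largest \<open>\<kappa>\<close> for which \<open>d - 1\<close> rotations by
  \<open>2 arctan \<kappa>\<close> add up to at most a right angle.
\<close>

lemma admissible_parameters:
  fixes \<eta> :: real
  assumes d: "d \<ge> 2" and \<eta>: "0 \<le> \<eta>" "\<eta> < eta_bound d"
  obtains \<eta>' \<tau> \<kappa> where "\<eta> < \<eta>'" "\<eta>' < 1" "0 < \<tau>" "\<tau> < 1" "\<eta>' + \<tau> \<le> \<kappa> * (1 - \<tau>)" "\<kappa> < 1"
    "(real d - 1) * (2 * arctan \<kappa>) \<le> pi / 2"
proof -
  define \<theta> where "\<theta> = pi / (4 * (real d - 1))"
  have \<theta>: "0 < \<theta>" "\<theta> \<le> pi / 4"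
    using d by (auto simp: \<theta>_def field_simps)
  then have \<theta>2: "- (pi / 2) < \<theta>" "\<theta> < pi / 2" using pi_gt_zero by linarith+
  have bound: "eta_bound d = tan \<theta>" by (simp add: eta_bound_def \<theta>_def)
  have le1: "eta_bound d \<le> 1"
  proof (cases "\<theta> = pi / 4")
    case True
    show ?thesis unfolding bound True tan_45 by simp
  next
    case False
    then have "tan \<theta> < tan (pi / 4)" using \<theta> \<theta>2 by (intro tan_monotone) auto
    then show ?thesis using bound by (simp add: tan_45)
  qed
  define \<kappa> where "\<kappa> = (\<eta> + eta_bound d) / 2"
  define \<eta>' where "\<eta>' = (\<eta> + \<kappa>) / 2"
  \<comment> \<open>The value of \<open>\<tau>\<close> turns \<open>\<eta>' + \<tau> \<le> \<kappa> (1 - \<tau>)\<close> into an equality.\<close>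
  define \<tau> where "\<tau> = (\<kappa> - \<eta>') / (1 + \<kappa>)"
  have k: "\<eta> < \<kappa>" "\<kappa> < eta_bound d" "\<kappa> < 1" "0 < \<kappa>" using \<eta> le1 by (auto simp: \<kappa>_def)
  then have e: "\<eta> < \<eta>'" "\<eta>' < \<kappa>" by (auto simp: \<eta>'_def)
  have t: "\<tau> * (1 + \<kappa>) = \<kappa> - \<eta>'" using k by (simp add: \<tau>_def)
  have "0 < \<tau>" using k e by (simp add: \<tau>_def)
  moreover have "\<tau> < 1" using k e \<eta> by (simp add: \<tau>_def)
  moreover have "\<eta>' + \<tau> \<le> \<kappa> * (1 - \<tau>)" using t by (simp add: algebra_simps)
  moreover have "(real d - 1) * (2 * arctan \<kappa>) \<le> pi / 2"
  proof -
    have "arctan \<kappa> \<le> arctan (tan \<theta>)" using k bound by (simp add: arctan_le_iff)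
    also have "\<dots> = \<theta>" using \<theta>2 by (intro arctan_tan)
    finally have "(real d - 1) * (2 * arctan \<kappa>) \<le> (real d - 1) * (2 * \<theta>)"
      using d by (intro mult_left_mono) auto
    also have "\<dots> = pi / 2" using d by (simp add: \<theta>_def field_simps)
    finally show ?thesis .
  qed
  ultimately show thesis using that[of \<eta>' \<tau> \<kappa>] e k by simp
qed

section \<open>Taylor polynomials of a function with bounded real part\<close>

text \<open>
  The Moebius transformation \<open>v \<mapsto> v / (2 M - v)\<close> maps the half-plane \<open>Re v < M\<close> into the unit disc and
  fixes 0. Schwarz's lemma applies to its composition with \<open>h\<close>, rescaled to the unit disc.
\<close>

lemma Borel_Caratheodory:
  fixes h :: "complex \<Rightarrow> complex"
  assumes holo: "h holomorphic_on ball 0 R" and h0: "h 0 = 0"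
    and Re_h: "\<And>z. norm z < R \<Longrightarrow> Re (h z) < M"
    and r: "0 < r" "r < R" and z: "norm z \<le> r"
  shows "norm (h z) \<le> 2 * M * r / (R - r)"
proof -
  have R: "R > 0" using r by simp
  have M: "M > 0" using Re_h[of 0] h0 R by simp
  define f where "f w = h (of_real R * w) / (of_real (2 * M) - h (of_real R * w))" for w
  have in_ball: "of_real R * w \<in> ball 0 R" if "norm w < 1" for w :: complex
    using that R by (simp add: norm_mult)
  have nz: "of_real (2 * M) - h (of_real R * w) \<noteq> 0" if "norm w < 1" for w
  proof
    assume "of_real (2 * M) - h (of_real R * w) = 0"
    then have "Re (h (of_real R * w)) = 2 * M" by (metis Re_complex_of_real eq_iff_diff_eq_0)
    then show False using Re_h[of "of_real R * w"] in_ball[OF that] M by simp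
  qed
  have holo_hR: "(\<lambda>w. h (of_real R * w)) holomorphic_on ball 0 1"
    by (rule holomorphic_on_compose_gen[OF _ holo, unfolded o_def])
       (use in_ball in \<open>auto intro!: holomorphic_intros\<close>)
  have holo_f: "f holomorphic_on ball 0 1"
    unfolding f_def using nz by (intro holomorphic_intros holo_hR) auto
  have f_less: "norm (f w) < 1" if "norm w < 1" for w
  proof -
    let ?v = "h (of_real R * w)"
    have "Re ?v < M" using Re_h in_ball[OF that] by simp
    then have "0 < 4 * M * (M - Re ?v)" using M by simp
    also have "\<dots> = (norm (of_real (2 * M) - ?v))\<^sup>2 - (norm ?v)\<^sup>2"
      unfolding cmod_power2 by (simp add: power2_eq_square algebra_simps)
    finally have "(norm ?v)\<^sup>2 < (norm (of_real (2 * M) - ?v))\<^sup>2" by linarith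
    then have "norm ?v < norm (of_real (2 * M) - ?v)"
      by (rule power2_less_imp_less) (rule norm_ge_zero)
    then show ?thesis using nz[OF that] by (simp add: f_def norm_divide)
  qed
  define w where "w = z / of_real R"
  have zw: "of_real R * w = z" using R by (simp add: w_def)
  have w: "norm w < 1" "norm w \<le> r / R"
    using z r R by (auto simp: w_def norm_divide divide_simps)
  have "norm (f w) \<le> norm w"
    using Schwarz_Lemma(1)[OF holo_f _ f_less w(1)] h0 by (simp add: f_def)
  then have fw: "norm (f w) \<le> r / R" using w by simp
  have "norm (h z) = norm (f w) * norm (of_real (2 * M) - h z)"
    using nz[OF w(1)] by (simp add: f_def zw norm_divide)
  also have "\<dots> \<le> r / R * (2 * M + norm (h z))"
  proof (rule mult_mono)
    show "norm (of_real (2 * M) - h z) \<le> 2 * M + norm (h z)"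
      using norm_triangle_ineq4[of "of_real (2 * M)" "h z"] M by simp
  qed (use fw r R M in auto)
  finally have "norm (h z) * (R - r) \<le> 2 * M * r"
    using R by (simp add: field_simps)
  then show ?thesis using r by (simp add: field_simps)
qed

lemma power_series_tail_bound:
  fixes c :: "nat \<Rightarrow> complex"
  assumes "r > 1" "\<And>k. norm (c k) \<le> B / r ^ k" "c sums s"
  shows "norm (s - (\<Sum>k\<le>m. c k)) \<le> B / (r - 1) / r ^ m"
proof -
  have geo: "(\<lambda>k. B / r ^ Suc m * (1 / r) ^ k) sums (B / r ^ Suc m * (1 / (1 - 1 / r)))"
    using assms(1) by (intro sums_mult geometric_sums) simp
  have "(\<lambda>k. c (k + Suc m)) sums (s - (\<Sum>k<Suc m. c k))"
    using assms(3) by (subst sums_iff_shift) simp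
  then have "s - (\<Sum>k\<le>m. c k) = suminf (\<lambda>k. c (k + Suc m))"
    by (simp add: sums_unique lessThan_Suc_atMost)
  also have "norm \<dots> \<le> suminf (\<lambda>k. B / r ^ Suc m * (1 / r) ^ k)"
  proof (rule norm_suminf_le)
    show "norm (c (k + Suc m)) \<le> B / r ^ Suc m * (1 / r) ^ k" for k
      using assms(2)[of "k + Suc m"] by (simp add: power_add power_one_over field_simps)
  qed (use geo in \<open>simp add: sums_iff\<close>)
  also have "\<dots> = B / r ^ Suc m * (1 / (1 - 1 / r))" using geo by (simp add: sums_iff)
  also have "\<dots> = B / (r - 1) / r ^ m" using assms(1) by (simp add: field_simps)
  finally show ?thesis .
qed

lemma Taylor_truncation_bound:
  fixes h :: "complex \<Rightarrow> complex"
  assumes holo: "h holomorphic_on ball 0 R" and h0: "h 0 = 0"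
    and Re_h: "\<And>z. norm z < R \<Longrightarrow> Re (h z) < M"
    and r: "1 < r" "r < R"
  shows "norm (h 1 - (\<Sum>k\<le>m. fps_nth (fps_expansion h 0) k)) \<le>
     (2 * M * r / (R - r)) / (r - 1) / r ^ m"
proof (rule power_series_tail_bound)
  let ?B = "2 * M * r / (R - r)"
  show "norm (fps_nth (fps_expansion h 0) k) \<le> ?B / r ^ k" for k
  proof -
    have "norm ((deriv ^^ k) h 0) \<le> fact k * ?B / r ^ k"
    proof (rule Cauchy_inequality)
      show "h holomorphic_on ball 0 r" by (rule holomorphic_on_subset[OF holo]) (use r in auto)
      show "continuous_on (cball 0 r) h"
        by (rule continuous_on_subset[OF holomorphic_on_imp_continuous_on[OF holo]]) (use r in auto)
      show "norm (h x) \<le> ?B" if "norm (0 - x) = r" for x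
        by (rule Borel_Caratheodory[OF holo h0 Re_h]) (use r that in auto)
    qed (use r in auto)
    then show ?thesis
      by (simp add: fps_expansion_def norm_divide field_simps)
  qed
  have "(\<lambda>n. (deriv ^^ n) h 0 / fact n * (1 - 0) ^ n) sums h 1"
    by (rule holomorphic_power_series[OF holo]) (use r in auto)
  moreover have "fps_nth (fps_expansion h 0) = (\<lambda>n. (deriv ^^ n) h 0 / fact n * (1 - 0) ^ n)"
    by (simp add: fun_eq_iff fps_expansion_def)
  ultimately show "fps_nth (fps_expansion h 0) sums h 1" by simp
qed (use r in auto)

section \<open>Mapping a disc into a thin strip\<close>

text \<open>
  The principal branch of the logarithm maps the right half-plane into a strip of bounded height, and
  \<open>1 - \<alpha> z\<close> stays in the right half-plane as long as \<open>|\<alpha> z| < 1\<close>. Normalized to map 1 to 1,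
  the map is \<open>\<phi>(z) = - ln (1 - \<alpha> z) / L\<close> with \<open>L = - ln (1 - \<alpha>)\<close>: as \<open>\<alpha>\<close> tends to 1, the strip becomes
  arbitrarily thin. The disc can be chosen larger than the unit disc, at the price of an excess
  of \<open>\<delta>\<close> in the real part.
\<close>

lemma exists_disc_to_strip_map:
  fixes \<delta> \<tau> :: real
  assumes "\<delta> > 0" "\<tau> > 0"
  obtains R \<phi> F where "R > 1" "\<phi> holomorphic_on ball 0 R" "\<phi> has_fps_expansion F"
    "F $ 0 = 0" "\<And>k. \<exists>c. F $ k = complex_of_real c" "\<phi> 1 = 1"
    "\<And>z. z \<in> ball 0 R \<Longrightarrow> \<bar>Re (\<phi> z)\<bar> \<le> 1 + \<delta> \<and> \<bar>Im (\<phi> z)\<bar> \<le> \<tau>"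
proof -
  \<comment> \<open>The summand \<open>2 / \<tau>\<close> makes the strip thin enough, as \<open>pi / (2 L) < 2 / L\<close>; the summand 1 makes the real
      part at least -1 where \<open>|1 - \<alpha> z|\<close> approaches 2. The radius \<open>R\<close> is the one with
      \<open>- ln (1 - \<alpha> R) = (1 + \<delta>) L\<close>.\<close>
  define L where "L = 1 + 2 / \<tau>"
  define \<alpha> where "\<alpha> = 1 - exp (- L)"
  define \<rho> where "\<rho> = 1 - exp (- ((1 + \<delta>) * L))"
  define R where "R = \<rho> / \<alpha>"
  define \<phi> where "\<phi> z = - Ln (1 + (- of_real \<alpha> * z)) / of_real L" for z
  define F :: "complex fps" where "F = Abs_fps (\<lambda>n. of_real (\<alpha> ^ n / real n / L))"
  have L: "L > 1" "2 / \<tau> < L" using assms by (auto simp: L_def)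
  have \<alpha>: "0 < \<alpha>" "\<alpha> < 1" using L by (auto simp: \<alpha>_def)
  have \<rho>: "\<alpha> < \<rho>" "\<rho> < 1" using L assms by (auto simp: \<alpha>_def \<rho>_def)
  have R: "R > 1" using \<alpha> \<rho> by (simp add: R_def)
  have small: "norm (of_real \<alpha> * z) < \<rho>" if "z \<in> ball 0 R" for z :: complex
    using that \<alpha> by (simp add: R_def norm_mult field_simps)
  have Re_pos: "Re (1 + (- of_real \<alpha> * z)) > 0" if "z \<in> ball 0 R" for z
    using small[OF that] complex_Re_le_cmod[of "of_real \<alpha> * z"] \<rho> by simp
  show thesis
  proof
    show "R > 1" by fact
    show "\<phi> holomorphic_on ball 0 R"
    proof -
      have "1 + (- of_real \<alpha> * z) \<notin> \<real>\<^sub>\<le>\<^sub>0" if "z \<in> ball 0 R" for z :: complex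
        using Re_pos[OF that] by (auto simp: complex_nonpos_Reals_iff)
      then show ?thesis unfolding \<phi>_def using L by (intro holomorphic_intros) auto
    qed
    show "\<phi> has_fps_expansion F"
    proof (rule has_fps_expansionI)
      have "eventually (\<lambda>z. z \<in> ball 0 R) (nhds (0::complex))"
        using R by (intro eventually_nhds_in_open) auto
      then show "eventually (\<lambda>u. (\<lambda>n. fps_nth F n * u ^ n) sums \<phi> u) (nhds 0)"
      proof eventually_elim
        case (elim z)
        have "(\<lambda>n. - ((- (- of_real \<alpha> * z)) ^ n) / of_nat n) sums Ln (1 + (- of_real \<alpha> * z))"
          using small[OF elim] \<rho> by (intro Ln_series') simp
        then have "(\<lambda>n. - (- ((- (- of_real \<alpha> * z)) ^ n) / of_nat n) / of_real L) sums \<phi> z"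
          unfolding \<phi>_def by (intro sums_divide sums_minus)
        then show ?case by (simp add: F_def power_mult_distrib field_simps)
      qed
    qed
    show "F $ 0 = 0" by (simp add: F_def)
    show "\<exists>c. F $ k = complex_of_real c" for k
      by (rule exI[of _ "\<alpha> ^ k / real k / L"]) (simp add: F_def)
    have "Ln (1 + (- of_real \<alpha> * 1)) = Ln (of_real (exp (- L)))" by (simp add: \<alpha>_def)
    also have "\<dots> = of_real (- L)" by (subst Ln_of_real) auto
    finally show "\<phi> 1 = 1" using L by (simp add: \<phi>_def)
    fix z :: complex assume z: "z \<in> ball 0 R"
    define w where "w = 1 + (- of_real \<alpha> * z)"
    have Re_w: "Re w > 0" unfolding w_def by (rule Re_pos[OF z])
    then have w0: "w \<noteq> 0" by auto
    have phi: "\<phi> z = - Ln w / of_real L" by (simp add: \<phi>_def w_def)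
    have "exp (- ((1 + \<delta>) * L)) \<le> norm w"
      using small[OF z] norm_diff_ineq[of 1 "- of_real \<alpha> * z"] by (simp add: \<rho>_def w_def)
    then have lower: "- ((1 + \<delta>) * L) \<le> ln (norm w)"
      using w0 by (simp add: ln_ge_iff)
    have "norm w \<le> 2"
      using small[OF z] \<rho> norm_triangle_ineq[of 1 "- of_real \<alpha> * z"]
      by (simp add: w_def)
    then have "ln (norm w) \<le> ln 2" using w0 by simp
    also have "\<dots> \<le> 1" using ln_2_less_1 by simp
    also have "\<dots> \<le> (1 + \<delta>) * L" using L assms by (simp add: mult_ge1_I)
    finally have upper: "ln (norm w) \<le> (1 + \<delta>) * L" .
    have "\<bar>Re (\<phi> z)\<bar> = \<bar>ln (norm w)\<bar> / L"
      using w0 L by (simp add: phi)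
    also have "\<dots> \<le> 1 + \<delta>"
      using lower upper L by (simp add: divide_le_eq abs_le_iff)
    finally have re: "\<bar>Re (\<phi> z)\<bar> \<le> 1 + \<delta>" .
    have "\<bar>Im (Ln w)\<bar> < pi / 2" using Re_w Re_Ln_pos_lt[OF w0] by blast
    also have "\<dots> \<le> 2" using pi_less_4 by simp
    also have "2 \<le> \<tau> * L" using L assms by (simp add: field_simps)
    finally have "\<bar>Im (Ln w)\<bar> / L \<le> \<tau>" using L by (simp add: field_simps)
    moreover have "\<bar>Im (\<phi> z)\<bar> = \<bar>Im (Ln w)\<bar> / L"
      using L by (simp add: phi)
    ultimately show "\<bar>Re (\<phi> z)\<bar> \<le> 1 + \<delta> \<and> \<bar>Im (\<phi> z)\<bar> \<le> \<tau>" using re by simp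
  qed
qed

text \<open>
  The excess \<open>\<eta>' - \<eta>\<close> allowed in the real part of the curve parameter is multiplied by
  \<open>|x - 1| \<le> \<eta> < 1\<close> and therefore fits between \<open>\<eta>\<close> and \<open>\<eta>'\<close>.
\<close>

lemma line_in_entry_box:
  fixes \<phi> :: complex and x :: real
  assumes "\<bar>1 - x\<bar> \<le> \<eta>" "\<bar>Re \<phi>\<bar> \<le> 1 + (\<eta>' - \<eta>)" "\<bar>Im \<phi>\<bar> \<le> \<tau> * (1 - \<eta>')"
    and "0 \<le> \<eta>" "\<eta> < \<eta>'" "\<eta>' < 1"
  shows "1 + \<phi> * (of_real x - 1) \<in> entry_box \<eta>' \<tau>"
proof -
  have re: "\<bar>Re \<phi>\<bar> * \<bar>x - 1\<bar> \<le> (1 + (\<eta>' - \<eta>)) * \<eta>"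
    using assms by (intro mult_mono) auto
  have "(\<eta>' - \<eta>) * \<eta> \<le> (\<eta>' - \<eta>) * 1" using assms by (intro mult_left_mono) auto
  then have re': "(1 + (\<eta>' - \<eta>)) * \<eta> \<le> \<eta>'" by (simp add: algebra_simps)
  have im: "\<bar>Im \<phi>\<bar> * \<bar>x - 1\<bar> \<le> \<bar>Im \<phi>\<bar> * 1"
    using assms by (intro mult_left_mono) auto
  show ?thesis
    using re re' im assms(3) by (simp add: entry_box_def abs_mult abs_minus_commute)
qed

lemma norm_entry_box_le:
  assumes "a \<in> entry_box \<eta> \<tau>" "0 \<le> \<eta>" "\<eta> < 1" "0 \<le> \<tau>" "\<tau> < 1"
  shows "norm a \<le> 3"
proof -
  have "\<tau> * (1 - \<eta>) \<le> 1 * 1" using assms by (intro mult_mono) auto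
  then show ?thesis
    using assms cmod_le[of a] by (auto simp: entry_box_def abs_le_iff)
qed

section \<open>Approximation of the logarithm of the permanent\<close>

text \<open>
  For the given \<open>m\<close> the polynomial is \<open>ln N\<close> plus the coefficients up to order \<open>m\<close> of the formal
  logarithm \<open>H\<close> of the normalized permanent along the curve. It is constructed for arbitrary entries, and the
  zero-free region is used only to compare it with \<open>ln (PER A)\<close>.
\<close>

lemma ln_PER_polynomial_approximation:
  fixes \<eta> :: real
  assumes d: "d \<ge> 2" and \<eta>: "0 \<le> \<eta>" "\<eta> < eta_bound d"
  obtains B r :: real where "B > 0" "r > 1"
    "\<And>n m. n \<ge> 1 \<Longrightarrow> \<exists>p :: (nat list, real) mpolynomial.
        mpoly_vars p \<subseteq> tensor_indices d n \<and> mpoly_degree p \<le> m \<and>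
        (\<forall>A. (\<forall>is \<in> tensor_indices d n. \<bar>1 - A is\<bar> \<le> \<eta>) \<longrightarrow>
           \<bar>ln (PER d n A) - mpoly_eval A p\<bar> \<le> B * real n / r ^ m)"
proof -
  obtain \<eta>' \<tau> \<kappa> where par: "\<eta> < \<eta>'" "\<eta>' < 1" "0 < \<tau>" "\<tau> < 1" "\<eta>' + \<tau> \<le> \<kappa> * (1 - \<tau>)" "\<kappa> < 1"
    "(real d - 1) * (2 * arctan \<kappa>) \<le> pi / 2"
    using admissible_parameters[OF d \<eta>] by blast
  then have "0 < \<eta>' - \<eta>" "0 < \<tau> * (1 - \<eta>')" by auto
  then obtain R \<phi> F where R: "R > 1" and \<phi>: "\<phi> holomorphic_on ball 0 R" "\<phi> has_fps_expansion F"
    "F $ 0 = 0" "\<And>k. \<exists>c. F $ k = complex_of_real c" "\<phi> 1 = 1"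
    and strip: "\<And>z. z \<in> ball 0 R \<Longrightarrow> \<bar>Re (\<phi> z)\<bar> \<le> 1 + (\<eta>' - \<eta>) \<and> \<bar>Im (\<phi> z)\<bar> \<le> \<tau> * (1 - \<eta>')"
    using exists_disc_to_strip_map[of "\<eta>' - \<eta>" "\<tau> * (1 - \<eta>')"] by blast
  have \<phi>0: "\<phi> 0 = 0" using has_fps_expansion_imp_0_eq_fps_nth_0[OF \<phi>(2)] \<phi>(3) by simp
  \<comment> \<open>Any radius strictly between 1 and \<open>R\<close> would do. The constant \<open>B\<close> is the one of
      \<open>Taylor_truncation_bound\<close> for \<open>M = 3 n\<close>, divided by \<open>n\<close>.\<close>
  define r where "r = (1 + R) / 2"
  have r: "1 < r" "r < R" using R by (auto simp: r_def)
  define B where "B = 6 * r / (R - r) / (r - 1)"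
  show thesis
  proof
    show "B > 0" using r by (simp add: B_def)
    show "r > 1" by fact
    fix n m :: nat assume n: "n \<ge> 1"
    define X where "X = (\<lambda>_::nat. {1..n})"
    define N where "N = real (card (matchings d X))"
    have N: "N > 0" using card_matchings_pos[OF d] by (simp add: N_def X_def)
    define G where "G A = fps_const (of_real (1 / N)) *
        matching_sum d X (\<lambda>e. 1 + F * fps_const (complex_of_real (A e) - 1))" for A
    define H where "H A = fps_integral0 (fps_deriv (G A) / G A)" for A
    have edges: "edges d X = tensor_indices d n" by (simp add: X_def tensor_indices_eq_edges)
    have G0: "G A $ 0 = 1" for A
    proof -
      have nth_prod: "(\<Prod>e\<in>M. f e) $ 0 = (\<Prod>e\<in>M. f e $ 0)"
        for f :: "nat list \<Rightarrow> complex fps" and M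
        by (induction M rule: infinite_finite_induct) auto
      have "matching_sum d X (\<lambda>e. 1 + F * fps_const (complex_of_real (A e) - 1)) $ 0 = of_real N"
        by (simp add: matching_sum_def fps_sum_nth nth_prod \<phi>(3) N_def)
      then show ?thesis using N by (simp add: G_def)
    qed
    have "graded_fps (tensor_indices d n) G"
      unfolding G_def matching_sum_def
      using matchings_subset_Pow_edges[of d X] unfolding edges
      by (intro graded_fps_mult graded_fps_const graded_fps_sum graded_fps_prod graded_fps_line[OF \<phi>(3,4)]) auto
    then have "graded_fps (tensor_indices d n) H"
      unfolding H_def using G0 by (rule graded_fps_log)
    then have "polynomial_fun (tensor_indices d n) m (\<lambda>A. of_real (ln N) + (\<Sum>k\<le>m. H A $ k))"
      unfolding graded_fps_def
      by (intro polynomial_fun_add polynomial_fun_const polynomial_fun_sum)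
        (auto intro: polynomial_fun_mono)
    then obtain p where p: "mpoly_vars p \<subseteq> tensor_indices d n" "mpoly_degree p \<le> m"
      "\<And>A. of_real (ln N) + (\<Sum>k\<le>m. H A $ k) = complex_of_real (mpoly_eval A p)"
      unfolding polynomial_fun_def by blast
    have "\<bar>ln (PER d n A) - mpoly_eval A p\<bar> \<le> B * real n / r ^ m"
      if A: "\<forall>is \<in> tensor_indices d n. \<bar>1 - A is\<bar> \<le> \<eta>" for A
    proof -
      define a where "a z e = 1 + \<phi> z * (complex_of_real (A e) - 1)" for z e
      define g where "g z = of_real (1 / N) * matching_sum d X (a z)" for z
      have a: "a z e \<in> entry_box \<eta>' \<tau>" if "z \<in> ball 0 R" "e \<in> edges d X" for z e
        unfolding a_def
        using A strip[OF that(1)] that(2) edges \<eta> par by (intro line_in_entry_box) auto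
      have nz: "g z \<noteq> 0" if z: "z \<in> ball 0 R" for z
      proof -
        \<comment> \<open>The entries outside the index range are arbitrary, so they are replaced by 1.\<close>
        let ?b = "\<lambda>e. if e \<in> edges d X then a z e else 1"
        have "matching_sum d X ?b \<noteq> 0"
          using matching_sum_nonzero_and_angle[of ?b \<eta>' \<tau> d \<kappa> X n] a[OF z] d par \<eta>
          by (auto simp: X_def entry_box_def)
        moreover have "matching_sum d X ?b = matching_sum d X (a z)"
          by (rule matching_sum_cong) simp
        ultimately show ?thesis using N by (simp add: g_def)
      qed
      have norm_g: "norm (g z) \<le> 3 ^ n" if z: "z \<in> ball 0 R" for z
      proof -
        have "norm (matching_sum d X (a z)) \<le> N * 3 ^ n"
          unfolding N_def
        proof (rule norm_matching_sum_le)
          show "norm (a z e) \<le> 3" if "e \<in> edges d X" for e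
            using norm_entry_box_le[OF a[OF z that]] \<eta> par by simp
        qed (use d in \<open>auto simp: X_def\<close>)
        then show ?thesis using N by (simp add: g_def norm_mult norm_divide field_simps)
      qed
      have holo_g: "g holomorphic_on ball 0 R"
        unfolding g_def matching_sum_def a_def by (intro holomorphic_intros \<phi>(1))
      have G: "g has_fps_expansion G A"
        unfolding g_def G_def matching_sum_def a_def
        by (intro fps_expansion_intros \<phi>(2))
      obtain h0 where h0: "h0 holomorphic_on ball 0 R" "\<And>z. z \<in> ball 0 R \<Longrightarrow> g z = exp (h0 z)"
        using contractible_imp_holomorphic_log[OF holo_g convex_imp_contractible[OF convex_ball] nz] by blast
      define h where "h z = h0 z - h0 0" for z
      have g0: "g 0 = 1" using has_fps_expansion_imp_0_eq_fps_nth_0[OF G] G0 by simp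
      then have "exp (h0 0) = 1" using h0(2)[of 0] R by simp
      then have exp_h: "g z = exp (h z)" if "z \<in> ball 0 R" for z
        using h0(2)[OF that] by (simp add: h_def exp_diff)
      have h: "h holomorphic_on ball 0 R" "h 0 = 0"
        unfolding h_def by (intro holomorphic_intros h0(1)) simp
      have Re_h: "Re (h z) < 3 * real n" if "norm z < R" for z
      proof -
        have "exp (Re (h z)) \<le> 3 ^ n"
          using norm_g[of z] exp_h[of z] that by simp
        also have "\<dots> = exp (real n * ln 3)" by (simp add: exp_of_nat_mult)
        finally have "Re (h z) \<le> real n * ln 3" by simp
        also have "ln 3 < (3::real)" using ln_less_self[of 3] by simp
        then have "real n * ln 3 < real n * 3" using n by (intro mult_strict_left_mono) auto
        finally show ?thesis by simp
      qed
      have H: "fps_expansion h 0 = H A"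
        unfolding H_def using h R exp_h G by (intro fps_expansion_log) auto
      have trunc: "norm (h 1 - (\<Sum>k\<le>m. H A $ k)) \<le> B * real n / r ^ m"
        using Taylor_truncation_bound[OF h Re_h r, of m] unfolding H B_def by (simp add: field_simps)
      have real_coeff: "Im (H A $ k) = 0" for k
      proof -
        from \<open>graded_fps (tensor_indices d n) H\<close>
        obtain q where "H A $ k = complex_of_real (mpoly_eval A q)"
          unfolding graded_fps_def polynomial_fun_def by blast
        then show ?thesis by simp
      qed
      have "(\<lambda>k. (deriv ^^ k) h 0 / fact k * (1 - 0) ^ k) sums h 1"
        using R by (intro holomorphic_power_series[OF h(1)]) simp
      moreover have "(\<lambda>k. (deriv ^^ k) h 0 / fact k * (1 - 0) ^ k) = (\<lambda>k. H A $ k)"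
        unfolding H[symmetric] by (simp add: fps_expansion_def)
      ultimately have "(\<lambda>k. H A $ k) sums h 1" by simp
      then have "(\<lambda>k. Im (H A $ k)) sums Im (h 1)" by (rule sums_Im)
      then have "Im (h 1) = 0" by (simp add: real_coeff sums_iff)
      then obtain t where h1: "h 1 = complex_of_real t" by (metis complex_is_Real_iff Reals_cases)
      have "complex_of_real (PER d n A) = matching_sum d X (\<lambda>e. complex_of_real (A e))"
        using d by (simp add: PER_eq_matching_sum matching_sum_def X_def)
      also have "(\<lambda>e. complex_of_real (A e)) = a 1" by (simp add: a_def \<phi>(5) fun_eq_iff)
      also have "matching_sum d X (a 1) = of_real N * g 1" using N by (simp add: g_def)
      also have "g 1 = of_real (exp t)" using exp_h[of 1] R h1 by (simp add: exp_of_real)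
      finally have "complex_of_real (PER d n A) = complex_of_real (N * exp t)" by simp
      then have "PER d n A = N * exp t" by (simp only: of_real_eq_iff)
      then have "ln (PER d n A) = ln N + t" using N by (simp add: ln_mult)
      then have "complex_of_real (ln (PER d n A) - mpoly_eval A p) = h 1 - (\<Sum>k\<le>m. H A $ k)"
        using h1 p(3)[of A, symmetric] by simp
      then show ?thesis using trunc by (metis norm_of_real)
    qed
    then show "\<exists>p :: (nat list, real) mpolynomial.
        mpoly_vars p \<subseteq> tensor_indices d n \<and> mpoly_degree p \<le> m \<and>
        (\<forall>A. (\<forall>is \<in> tensor_indices d n. \<bar>1 - A is\<bar> \<le> \<eta>) \<longrightarrow>
           \<bar>ln (PER d n A) - mpoly_eval A p\<bar> \<le> B * real n / r ^ m)"
      using p(1,2) by blast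
  qed
qed

text \<open>
  The least \<open>m\<close> with \<open>B x \<le> r ^ m\<close> is an affine function of \<open>ln x\<close>, up to rounding. The lower bound \<open>c\<close> on \<open>ln x\<close>
  lets the constant terms be absorbed into the factor \<open>\<gamma>\<close>.
\<close>

lemma logarithmic_degree_suffices:
  fixes B r c :: real
  assumes "B > 0" "r > 1" "c > 0"
  obtains \<gamma> :: real where "\<gamma> \<ge> 0"
    "\<And>x. c \<le> ln x \<Longrightarrow> x > 0 \<Longrightarrow> \<exists>m. real m \<le> \<gamma> * ln x \<and> B * x \<le> r ^ m"
proof -
  define C where "C = max 1 B"
  have C: "C \<ge> 1" "B \<le> C" by (auto simp: C_def)
  have lnr: "ln r > 0" using assms by simp
  have lnC: "ln C \<ge> 0" using C by simp
  define \<gamma> where "\<gamma> = (1 + ln C / c) / ln r + 1 / c"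
  show thesis
  proof
    show "\<gamma> \<ge> 0" using lnr lnC assms by (simp add: \<gamma>_def)
    fix x :: real assume x: "c \<le> ln x" "x > 0"
    define m where "m = nat \<lceil>(ln x + ln C) / ln r\<rceil>"
    have pos: "0 \<le> (ln x + ln C) / ln r" using x assms lnC lnr by simp
    have m_ge: "(ln x + ln C) / ln r \<le> real m" unfolding m_def by (rule real_nat_ceiling_ge)
    have m_le: "real m \<le> (ln x + ln C) / ln r + 1" unfolding m_def using pos by linarith
    have "1 \<le> ln x / c" using x assms by simp
    moreover from this have "ln C * 1 \<le> ln C * (ln x / c)" using lnC by (intro mult_left_mono)
    then have "(ln x + ln C) / ln r \<le> (ln x + ln C * (ln x / c)) / ln r"
      using lnr by (intro divide_right_mono) auto
    ultimately have "real m \<le> (ln x + ln C * (ln x / c)) / ln r + ln x / c" using m_le by linarith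
    also have "\<dots> = \<gamma> * ln x" by (simp add: \<gamma>_def algebra_simps add_divide_distrib)
    finally have deg: "real m \<le> \<gamma> * ln x" .
    have "B * x \<le> C * x" using C x by simp
    also have "\<dots> = exp (ln x + ln C)" using C x by (simp add: exp_add)
    also have "\<dots> \<le> exp (real m * ln r)" using m_ge lnr by (simp add: pos_divide_le_eq)
    also have "\<dots> = r ^ m" using assms by (simp add: exp_of_nat_mult)
    finally show "\<exists>m. real m \<le> \<gamma> * ln x \<and> B * x \<le> r ^ m" using deg by blast
  qed
qed

lemma PER_one: "PER d 1 A = A (1 # replicate (d - 1) 1)"
proof -
  have "{ss. length ss = d - 1 \<and> set ss \<subseteq> {\<sigma>. \<sigma> permutes {1..1::nat}}} = {replicate (d - 1) id}"
    by (auto simp: permutes_sing intro!: replicate_eqI)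
  then show ?thesis by (simp add: PER_def)
qed

lemma artanh_less_1:
  fixes \<eta> :: real
  assumes "0 \<le> \<eta>" "\<eta> < tanh 1"
  shows "artanh \<eta> < 1"
proof -
  define t :: real where "t = tanh 1"
  have t: "\<eta> < t" "t < 1" using assms tanh_real_lt_1[of 1] by (auto simp: t_def)
  have "(1 + \<eta>) / (1 - \<eta>) < (1 + t) / (1 - t)"
    using t assms by (intro frac_less) auto
  then have "artanh \<eta> < artanh t"
    using t assms by (simp add: artanh_def)
  then show ?thesis by (simp add: t_def artanh_tanh_real)
qed

text \<open>
  The best constant approximation of \<open>ln\<close> on \<open>[1 - \<eta>, 1 + \<eta>]\<close> is the midpoint of its range, and half the length
  of that range is \<open>artanh \<eta>\<close>.
\<close>

lemma abs_ln_minus_midpoint_le_artanh: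
  fixes \<eta> a :: real
  assumes "0 \<le> \<eta>" "\<eta> < 1" "\<bar>1 - a\<bar> \<le> \<eta>"
  shows "\<bar>ln a - (ln (1 + \<eta>) + ln (1 - \<eta>)) / 2\<bar> \<le> artanh \<eta>"
proof -
  have "ln (1 - \<eta>) \<le> ln a" "ln a \<le> ln (1 + \<eta>)" using assms by auto
  moreover have "artanh \<eta> = (ln (1 + \<eta>) - ln (1 - \<eta>)) / 2"
    using assms by (simp add: artanh_def ln_div)
  ultimately show ?thesis by (simp add: abs_le_iff field_simps)
qed

theorem theorem3p4:
  fixes d :: nat and \<eta> :: real
  assumes "d \<ge> 2" and "0 \<le> \<eta>" and "\<eta> < eta_bound d"
  shows "\<exists>\<gamma>::real. \<forall>(n::nat) (\<epsilon>::real).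
           n \<ge> 1 \<and> 0 < \<epsilon> \<and> \<epsilon> < 1 \<and> (n \<ge> 2 \<or> \<eta> < tanh 1) \<longrightarrow>
           (\<exists>p :: (nat list, real) mpolynomial.
              mpoly_vars p \<subseteq> tensor_indices d n \<and>
              real (mpoly_degree p) \<le> \<gamma> * (ln (real n) - ln \<epsilon>) \<and>
              (\<forall>A :: nat list \<Rightarrow> real.
                 (\<forall>is \<in> tensor_indices d n. \<bar>1 - A is\<bar> \<le> \<eta>) \<longrightarrow>
                 \<bar>ln (PER d n A) - mpoly_eval A p\<bar> \<le> \<epsilon>))"
proof -
  obtain B r where Br: "B > 0" "r > 1" and approx: "\<And>n m. n \<ge> 1 \<Longrightarrow>
      \<exists>p :: (nat list, real) mpolynomial.
        mpoly_vars p \<subseteq> tensor_indices d n \<and> mpoly_degree p \<le> m \<and>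
        (\<forall>A. (\<forall>is \<in> tensor_indices d n. \<bar>1 - A is\<bar> \<le> \<eta>) \<longrightarrow>
           \<bar>ln (PER d n A) - mpoly_eval A p\<bar> \<le> B * real n / r ^ m)"
    using ln_PER_polynomial_approximation[OF assms] by blast
  obtain \<eta>' where "\<eta> < \<eta>'" "\<eta>' < 1" using admissible_parameters[OF assms] by blast
  then have \<eta>1: "\<eta> < 1" by simp
  \<comment> \<open>A positive lower bound for \<open>ln n - ln \<epsilon>\<close>. It exists except when \<open>n = 1\<close> and \<open>\<epsilon>\<close> is close to 1, where
      the degree bound tends to 0; in that case, delimited by \<open>artanh \<eta> \<le> \<epsilon>\<close>, a constant is a
      sufficiently good approximation.\<close>
  define c where "c = (if 0 < artanh \<eta> \<and> artanh \<eta> < 1 then min (ln 2) (- ln (artanh \<eta>)) else ln 2)"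
  have "c > 0" by (auto simp: c_def)
  then obtain \<gamma> where \<gamma>: "\<gamma> \<ge> 0"
    "\<And>x. c \<le> ln x \<Longrightarrow> x > 0 \<Longrightarrow> \<exists>m. real m \<le> \<gamma> * ln x \<and> B * x \<le> r ^ m"
    using logarithmic_degree_suffices[OF Br] by blast
  show ?thesis
  proof (rule exI[of _ \<gamma>], intro allI impI)
    fix n :: nat and \<epsilon> :: real
    assume "n \<ge> 1 \<and> 0 < \<epsilon> \<and> \<epsilon> < 1 \<and> (n \<ge> 2 \<or> \<eta> < tanh 1)"
    then have n: "n \<ge> 1" and \<epsilon>: "0 < \<epsilon>" "\<epsilon> < 1" and side: "n \<ge> 2 \<or> \<eta> < tanh 1" by auto
    have ln_eq: "ln (real n / \<epsilon>) = ln (real n) - ln \<epsilon>" using n \<epsilon> by (simp add: ln_div)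
    let ?goal = "\<exists>p :: (nat list, real) mpolynomial.
              mpoly_vars p \<subseteq> tensor_indices d n \<and>
              real (mpoly_degree p) \<le> \<gamma> * (ln (real n) - ln \<epsilon>) \<and>
              (\<forall>A :: nat list \<Rightarrow> real.
                 (\<forall>is \<in> tensor_indices d n. \<bar>1 - A is\<bar> \<le> \<eta>) \<longrightarrow>
                 \<bar>ln (PER d n A) - mpoly_eval A p\<bar> \<le> \<epsilon>)"
    show ?goal
    proof (cases "n = 1 \<and> artanh \<eta> \<le> \<epsilon>")
      case True
      define p :: "(nat list, real) mpolynomial" where
        "p = Poly_Mapping.single 0 ((ln (1 + \<eta>) + ln (1 - \<eta>)) / 2)"
      have "ln \<epsilon> < 0" using \<epsilon> by simp
      moreover have "mpoly_degree p \<le> 0"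
        unfolding mpoly_degree_le_iff by (auto simp: p_def split: if_splits)
      ultimately have "real (mpoly_degree p) \<le> \<gamma> * (ln (real n) - ln \<epsilon>)"
        using \<gamma>(1) True by (auto simp: mult_nonneg_nonpos)
      moreover have "mpoly_vars p \<subseteq> tensor_indices d n"
        by (auto simp: p_def mpoly_vars_def split: if_splits)
      moreover have "\<bar>ln (PER d n A) - mpoly_eval A p\<bar> \<le> \<epsilon>"
        if "\<forall>is \<in> tensor_indices d n. \<bar>1 - A is\<bar> \<le> \<eta>" for A
      proof -
        have "1 # replicate (d - 1) 1 \<in> tensor_indices d n"
          using assms(1) True by (auto simp: tensor_indices_def)
        then have "\<bar>1 - PER d n A\<bar> \<le> \<eta>" using that True PER_one[of d A] by auto
        then show ?thesis
          using abs_ln_minus_midpoint_le_artanh[OF assms(2) \<eta>1] True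
          by (fastforce simp: p_def mpoly_eval_single)
      qed
      ultimately show ?goal by blast
    next
      case False
      have "c \<le> ln (real n / \<epsilon>)"
      proof (cases "n \<ge> 2")
        case True
        have "c \<le> ln 2" by (simp add: c_def)
        also have "\<dots> \<le> ln (real n)" using True by simp
        also have "\<dots> \<le> ln (real n / \<epsilon>)" using ln_eq \<epsilon> by simp
        finally show ?thesis .
      next
        case n1: False
        then have "n = 1" "\<epsilon> < artanh \<eta>" "artanh \<eta> < 1"
          using n False side artanh_less_1[OF assms(2)] by auto
        moreover from this have "ln \<epsilon> \<le> ln (artanh \<eta>)" using \<epsilon> by simp
        ultimately show ?thesis using ln_eq \<epsilon> by (simp add: c_def min_le_iff_disj)
      qed
      then obtain m where m: "real m \<le> \<gamma> * ln (real n / \<epsilon>)" "B * (real n / \<epsilon>) \<le> r ^ m"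
        using \<gamma>(2)[of "real n / \<epsilon>"] n \<epsilon> by auto
      have "B * real n / r ^ m \<le> \<epsilon>"
        using m(2) \<epsilon> Br by (simp add: field_simps)
      moreover obtain p :: "(nat list, real) mpolynomial" where
        p: "mpoly_vars p \<subseteq> tensor_indices d n" "mpoly_degree p \<le> m"
        "\<And>A. \<forall>is \<in> tensor_indices d n. \<bar>1 - A is\<bar> \<le> \<eta> \<Longrightarrow>
           \<bar>ln (PER d n A) - mpoly_eval A p\<bar> \<le> B * real n / r ^ m"
        using approx[OF n] by metis
      moreover have "real (mpoly_degree p) \<le> \<gamma> * (ln (real n) - ln \<epsilon>)"
        using p(2) m(1) ln_eq by simp
      ultimately show ?goal by (meson order_trans)
    qed
  qed
qed

end
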